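(* Let $y_h\in\mathcal{Y}^h$ satisfy $y_h'>0$, and define the functional $R_{\rm int}\in(\mathcal{U}^\varepsilon)^*$ by $R_{\rm int}[v]:=\mathcal{E}_{\rm a}'(y_h)[v]-\mathcal{E}_{\rm qc}'(y_h)[I_hv]$ for $v\in\mathcal{U}^\varepsilon$. Then $$\|R_{\rm int}\|_{\mathcal{U}^{-1,2}}\le\Big(3\sum_{k\in\mathcal{K}_{\rm c}}\eta_k^2\Big)^{1/2},$$ where $$\eta_k^2:=\sum_{\substack{b\in\mathcal{B}\\ x_k^h\in b \ (\mathrm{mod}\ 1)}}\Big(\big\|\phi'(r_bD_by_h)-\phi'(r_bD_{b\cap\Omega_{\rm a}^\#}y_h)\big\|_{L^2(b\cap\Omega_{\rm a}^\#)}^2+\big\|\phi'(r_bD_by_h)-\phi'(r_by_h')\big\|_{L^2(b\cap\Omega_{\rm c}^\#)}^2\Big).$$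
   Context: Atomistic model. Fix $N\in\mathbb{N}$, $F>0$, $\varepsilon=1/(2N)$. $\phi\in C^3(0,\infty)$ is an interaction potential for which there is $r_*>0$ such that $\phi$ is convex on $(0,r_* )$ and concave on $(r_*,\infty)$. A lattice function $v\in\mathbb{R}^{\mathbb{Z}}$ is identified with its continuous piecewise affine interpolant with $v(\varepsilon\ell)=v_\ell$; conversely a continuous function $g$ is identified with its nodal values $g_\ell=g(\varepsilon\ell)$ where a lattice function is needed. $v'_\ell:=(v_\ell-v_{\ell-1})/\varepsilon$. $\mathcal{U}^\varepsilon:=\{u\in\mathbb{R}^{\mathbb{Z}}:u_{\ell+2N}=u_\ell,\ u_0=0\}$, with norm $\|v\|_{\mathcal{U}^{1,2}}:=\|v'\|_{L^2(-1/2,1/2)}$ and dual norm $\|T\|_{\mathcal{U}^{-1,2}}:=\sup\{T[v]:v\in\mathcal{U}^\varepsilon,\ \|v\|_{\mathcal{U}^{1,2}}=1\}$. Bonds. $\mathcal{B}:=\{(\ell\varepsilon,(\ell+j)\varepsilon):j=1,2;\ \ell=-N+1,\dots,N\}$ (open intervals); $r_b:=j$ for $b=(\ell\varepsilon,(\ell+j)\varepsilon)$. For an open interval $\omega=(L,R)$ with $|\omega|=R-L>0$, $D_\omega v:=(v(R)-v(L))/|\omega|$. The atomistic stored energy is $\mathcal{E}_{\rm a}(y)=\varepsilon\sum_{b\in\mathcal{B}}\phi(r_bD_by)$, with $\mathcal{E}_{\rm a}'(y)[v]=\varepsilon\sum_{b\in\mathcal{B}}\phi'(r_bD_by)\,r_bD_bv$.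 Mesh. $\Omega=[-1/2,1/2]$; $\Omega_{\rm a}=(L_{\rm a},R_{\rm a})$ with $-1/2<L_{\rm a}<R_{\rm a}<1/2$; $\Omega_{\rm c}=\Omega\setminus\Omega_{\rm a}$; $\Omega_{\rm a}^\#=\Omega_{\rm a}+\mathbb{Z}$, $\Omega_{\rm c}^\#=\Omega_{\rm c}+\mathbb{Z}$. $\mathcal{T}^h$ is a partition of $\mathbb{R}$ into closed intervals $T_k^h=[x_{k-1}^h,x_k^h]$ ($k\in\mathbb{Z}$, $x^h_{k-1}<x^h_k$), of length $h_k$, such that: (T1) for some $K\in\mathbb{N}$, $x^h_{k+K}=x_k^h+1$ for all $k$; (T2) $\Omega_{\rm a}\cap\varepsilon\mathbb{Z}=\Omega_{\rm a}\cap\{x_k^h\}_{k\in\mathbb{Z}}$; (T3) $L_{\rm a},R_{\rm a}\in\{x_k^h\}$; (T4) $h_k\ge2\varepsilon$ whenever $T_k^h\subset\Omega_{\rm c}^\#$. Nodes are numbered so that $x_1^h,\dots,x_K^h$ are exactly the nodes in $(-1/2,1/2]$. $\mathcal{P}_1(\mathcal{T}^h)$ is the space of continuous functions that are affine on each $T_k^h$; $\mathcal{U}^h:=\{u\in\mathcal{P}_1(\mathcal{T}^h):u\text{ is 1-periodic},\ u(0)=0\}$, $\mathcal{Y}^h:=\{y\in\mathcal{P}_1(\mathcal{T}^h):y-Fx\in\mathcal{U}^h\}$. $I_h:C^0(\mathbb{R})\to\mathcal{P}_1(\mathcal{T}^h)$ is nodal interpolation at the $x_k^h$. $\mathcal{K}_{\rm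 c}:=\{k\in\{1,\dots,K\}:x_k^h\in\Omega_{\rm c}\}$. "$x_k^h\in b$ (mod 1)" means $x_k^h+m\in b$ for some $m\in\mathbb{Z}$. QC energy. $\mathcal{E}_{\rm qc}(y)=\varepsilon\sum_{b\in\mathcal{B}}[a_b(y)+c_b(y)]$, where $a_b(y)=\frac{|b\cap\Omega_{\rm a}^\#|}{|b|}\phi(r_bD_{b\cap\Omega_{\rm a}^\#}y)$ (and $a_b\equiv0$ if $|b\cap\Omega_{\rm a}^\#|=0$), $c_b(y)=\frac1{|b|}\int_{b\cap\Omega_{\rm c}^\#}\phi(r_by'(x))\,dx$. Note $b\cap\Omega_{\rm a}^\#$ is empty or an open interval. Its derivative is $\mathcal{E}_{\rm qc}'(y)[v]=\sum_{b\in\mathcal{B}}|b\cap\Omega_{\rm a}^\#|\,\phi'(r_bD_{b\cap\Omega_{\rm a}^\#}y)\,D_{b\cap\Omega_{\rm a}^\#}v+\sum_{b\in\mathcal{B}}\int_{b\cap\Omega_{\rm c}^\#}\phi'(r_by')\,v'\,dx$, where terms with $|b\cap\Omega_{\rm a}^\#|=0$ are zero. *)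

theory Defs
  imports "HOL-Analysis.Analysis"
begin

section \<open>Interaction potential\<close>

definition C3_pos :: "(real \<Rightarrow> real) \<Rightarrow> bool" where
  "C3_pos \<phi> \<longleftrightarrow>
     (\<forall>k<3. \<forall>r>0. (deriv ^^ k) \<phi> differentiable (at r)) \<and>
     continuous_on {0<..} ((deriv ^^ 3) \<phi>)"

definition convex_concave :: "(real \<Rightarrow> real) \<Rightarrow> bool" where
  "convex_concave \<phi> \<longleftrightarrow>
     (\<exists>r0>0. convex_on {0<..<r0} \<phi> \<and> concave_on {r0<..} \<phi>)"


section \<open>Piecewise affine functions on one-dimensional grids\<close>

text \<open>A grid is given by its nodes \<open>x k\<close>, \<open>k \<in> \<int>\<close>; element \<open>k\<close> is \<open>[x (k - 1), x k]\<close>.\<close>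

definition elem :: "(int \<Rightarrow> real) \<Rightarrow> int \<Rightarrow> real set" where
  "elem x k = {x (k - 1)..x k}"

definition P1 :: "(int \<Rightarrow> real) \<Rightarrow> (real \<Rightarrow> real) set" where
  "P1 x = {p. continuous_on UNIV p \<and> (\<forall>k. \<exists>a b. \<forall>t\<in>elem x k. p t = a + b * t)}"

definition interp :: "(int \<Rightarrow> real) \<Rightarrow> (int \<Rightarrow> real) \<Rightarrow> real \<Rightarrow> real" where
  "interp x w t =
     (let k = (THE k. x (k - 1) \<le> t \<and> t < x k)
      in w (k - 1) + (t - x (k - 1)) / (x k - x (k - 1)) * (w k - w (k - 1)))"

definition nodal_interp :: "(int \<Rightarrow> real) \<Rightarrow> (real \<Rightarrow> real) \<Rightarrow> real \<Rightarrow> real" where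
  "nodal_interp x g = interp x (\<lambda>k. g (x k))"

definition L2_norm :: "real set \<Rightarrow> (real \<Rightarrow> real) \<Rightarrow> real" where
  "L2_norm S f = sqrt (LINT t:S|lborel. (f t)\<^sup>2)"


section \<open>Lattice functions\<close>

definition eps :: "nat \<Rightarrow> real" where
  "eps N = 1 / (2 * real N)"

definition lattice :: "nat \<Rightarrow> int \<Rightarrow> real" where
  "lattice N l = eps N * real_of_int l"

text \<open>A lattice function is a function \<open>v :: int \<Rightarrow> real\<close>; the continuous function it is
  identified with is \<open>interp (lattice N) v\<close>.\<close>

definition U_eps :: "nat \<Rightarrow> (int \<Rightarrow> real) set" where
  "U_eps N = {v. (\<forall>l. v (l + 2 * int N) = v l) \<and> v 0 = 0}"

definition norm_U12 :: "nat \<Rightarrow> (int \<Rightarrow> real) \<Rightarrow> real" where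
  "norm_U12 N v = L2_norm {-1/2<..<1/2} (deriv (interp (lattice N) v))"

text \<open>The supremum is taken in the extended reals, so that a bound on it is never an artefact
  of the unspecified value of a real supremum over an unbounded set.\<close>

definition dual_norm :: "nat \<Rightarrow> ((int \<Rightarrow> real) \<Rightarrow> real) \<Rightarrow> ereal" where
  "dual_norm N T = (SUP v\<in>{v \<in> U_eps N. norm_U12 N v = 1}. ereal (T v))"


section \<open>Bonds and the atomistic energy\<close>

text \<open>The pair \<open>(l, j)\<close> encodes the bond \<open>(l \<epsilon>, (l + j) \<epsilon>)\<close>, so that \<open>r\<^sub>b\<close> is the second component.\<close>

definition bonds :: "nat \<Rightarrow> (int \<times> int) set" where
  "bonds N = {- int N + 1..int N} \<times> {1, 2}"

definition bond :: "nat \<Rightarrow> int \<times> int \<Rightarrow> real set" where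
  "bond N b = {lattice N (fst b)<..<lattice N (fst b + snd b)}"

definition rb :: "int \<times> int \<Rightarrow> real" where
  "rb b = real_of_int (snd b)"

abbreviation len :: "real set \<Rightarrow> real" where
  "len \<omega> \<equiv> measure lborel \<omega>"

text \<open>For a nonempty open interval \<open>\<omega> = (L, R)\<close> this is \<open>(v(R) - v(L)) / (R - L)\<close>.\<close>

definition Dq :: "real set \<Rightarrow> (real \<Rightarrow> real) \<Rightarrow> real" where
  "Dq \<omega> v = (v (Sup \<omega>) - v (Inf \<omega>)) / (Sup \<omega> - Inf \<omega>)"

definition E_a :: "nat \<Rightarrow> (real \<Rightarrow> real) \<Rightarrow> (real \<Rightarrow> real) \<Rightarrow> real" where
  "E_a N \<phi> y = eps N * (\<Sum>b\<in>bonds N. \<phi> (rb b * Dq (bond N b) y))"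

definition dE_a :: "nat \<Rightarrow> (real \<Rightarrow> real) \<Rightarrow> (real \<Rightarrow> real) \<Rightarrow> (real \<Rightarrow> real) \<Rightarrow> real" where
  "dE_a N \<phi> y v =
     eps N * (\<Sum>b\<in>bonds N. deriv \<phi> (rb b * Dq (bond N b) y) * (rb b * Dq (bond N b) v))"


section \<open>Atomistic and continuum regions, meshes\<close>

definition Om_a :: "real \<Rightarrow> real \<Rightarrow> real set" where
  "Om_a La Ra = {La<..<Ra}"

definition Om_c :: "real \<Rightarrow> real \<Rightarrow> real set" where
  "Om_c La Ra = {-1/2..1/2} - Om_a La Ra"

definition per :: "real set \<Rightarrow> real set" where
  "per S = {t + real_of_int m | t m. t \<in> S}"

definition is_mesh :: "nat \<Rightarrow> real \<Rightarrow> real \<Rightarrow> nat \<Rightarrow> (int \<Rightarrow> real) \<Rightarrow> bool" where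
  "is_mesh N La Ra K x \<longleftrightarrow>
     strict_mono x \<and> (\<Union>k. elem x k) = UNIV \<and>
     (\<forall>k. x (k + int K) = x k + 1) \<and>
     Om_a La Ra \<inter> range (lattice N) = Om_a La Ra \<inter> range x \<and>
     La \<in> range x \<and> Ra \<in> range x \<and>
     (\<forall>k. elem x k \<subseteq> per (Om_c La Ra) \<longrightarrow> x k - x (k - 1) \<ge> 2 * eps N) \<and>
     x ` {1..int K} = range x \<inter> {-1/2<..1/2}"

definition U_h :: "(int \<Rightarrow> real) \<Rightarrow> (real \<Rightarrow> real) set" where
  "U_h x = {u \<in> P1 x. (\<forall>t. u (t + 1) = u t) \<and> u 0 = 0}"

definition Y_h :: "real \<Rightarrow> (int \<Rightarrow> real) \<Rightarrow> (real \<Rightarrow> real) set" where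
  "Y_h F x = {y \<in> P1 x. (\<lambda>t. y t - F * t) \<in> U_h x}"

definition pos_deriv :: "(int \<Rightarrow> real) \<Rightarrow> (real \<Rightarrow> real) \<Rightarrow> bool" where
  "pos_deriv x y \<longleftrightarrow> (\<forall>t. t \<notin> range x \<longrightarrow> deriv y t > 0)"


section \<open>The quasicontinuum energy\<close>

text \<open>Since mesh elements in the periodic continuum region have length at least \<open>2 \<epsilon>\<close>, the set
  \<open>b_a\<close> below is empty or an open interval, so \<open>Dq\<close> is its difference quotient. If it is empty, the
  unspecified value of \<open>Dq\<close> is multiplied by length zero or integrated over the empty set.\<close>

abbreviation b_a :: "nat \<Rightarrow> real \<Rightarrow> real \<Rightarrow> int \<times> int \<Rightarrow> real set" where
  "b_a N La Ra b \<equiv> bond N b \<inter> per (Om_a La Ra)"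

abbreviation b_c :: "nat \<Rightarrow> real \<Rightarrow> real \<Rightarrow> int \<times> int \<Rightarrow> real set" where
  "b_c N La Ra b \<equiv> bond N b \<inter> per (Om_c La Ra)"

definition E_qc :: "nat \<Rightarrow> (real \<Rightarrow> real) \<Rightarrow> real \<Rightarrow> real \<Rightarrow> (real \<Rightarrow> real) \<Rightarrow> real" where
  "E_qc N \<phi> La Ra y = eps N * (\<Sum>b\<in>bonds N.
       len (b_a N La Ra b) / len (bond N b) * \<phi> (rb b * Dq (b_a N La Ra b) y)
     + 1 / len (bond N b) * (LINT t:b_c N La Ra b|lborel. \<phi> (rb b * deriv y t)))"

definition dE_qc ::
  "nat \<Rightarrow> (real \<Rightarrow> real) \<Rightarrow> real \<Rightarrow> real \<Rightarrow> (real \<Rightarrow> real) \<Rightarrow> (real \<Rightarrow> real) \<Rightarrow> real" where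
  "dE_qc N \<phi> La Ra y v =
     (\<Sum>b\<in>bonds N. len (b_a N La Ra b) *
        deriv \<phi> (rb b * Dq (b_a N La Ra b) y) * Dq (b_a N La Ra b) v)
   + (\<Sum>b\<in>bonds N. LINT t:b_c N La Ra b|lborel. deriv \<phi> (rb b * deriv y t) * deriv v t)"


section \<open>Internal residual and error indicators\<close>

definition R_int ::
  "nat \<Rightarrow> (real \<Rightarrow> real) \<Rightarrow> real \<Rightarrow> real \<Rightarrow> (int \<Rightarrow> real) \<Rightarrow> (real \<Rightarrow> real) \<Rightarrow> (int \<Rightarrow> real) \<Rightarrow> real"
where
  "R_int N \<phi> La Ra x y v =
     dE_a N \<phi> y (interp (lattice N) v)
   - dE_qc N \<phi> La Ra y (nodal_interp x (interp (lattice N) v))"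

definition K_c :: "real \<Rightarrow> real \<Rightarrow> nat \<Rightarrow> (int \<Rightarrow> real) \<Rightarrow> int set" where
  "K_c La Ra K x = {k \<in> {1..int K}. x k \<in> Om_c La Ra}"

definition eta_sq ::
  "nat \<Rightarrow> (real \<Rightarrow> real) \<Rightarrow> real \<Rightarrow> real \<Rightarrow> (int \<Rightarrow> real) \<Rightarrow> (real \<Rightarrow> real) \<Rightarrow> int \<Rightarrow> real"
where
  "eta_sq N \<phi> La Ra x y k =
     (\<Sum>b\<in>{b \<in> bonds N. \<exists>m::int. x k + real_of_int m \<in> bond N b}.
        (L2_norm (b_a N La Ra b)
           (\<lambda>t. deriv \<phi> (rb b * Dq (bond N b) y) - deriv \<phi> (rb b * Dq (b_a N La Ra b) y)))\<^sup>2
      + (L2_norm (b_c N La Ra b)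
           (\<lambda>t. deriv \<phi> (rb b * Dq (bond N b) y) - deriv \<phi> (rb b * deriv y t)))\<^sup>2)"


section \<open>Consistency of the definitions\<close>

lemma elem_exists:
  assumes x: "strict_mono x" and cov: "(\<Union>k. elem x k) = (UNIV :: real set)"
  obtains k where "x (k - 1) \<le> t" "t < x k"
proof -
  obtain k where k: "x (k - 1) \<le> t" "t \<le> x k"
    using cov by (force simp: elem_def)
  show thesis
  proof (cases "t = x k")
    case True
    then show thesis
      using that[of "k + 1"] strict_monoD[OF x, of k "k + 1"] by simp
  next
    case False
    then show thesis using that k by force
  qed
qed

lemma interp_eq:
  assumes x: "strict_mono x" and t: "t \<in> elem x k"
  shows "interp x w t = w (k - 1) + (t - x (k - 1)) / (x k - x (k - 1)) * (w k - w (k - 1))"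
proof -
  have the: "(THE i. x (i - 1) \<le> s \<and> s < x i) = j" if "x (j - 1) \<le> s" "s < x j" for s j
  proof (rule the_equality)
    fix i assume i: "x (i - 1) \<le> s \<and> s < x i"
    have "x (i - 1) < x j" "x (j - 1) < x i" using i that by linarith+
    then have "i - 1 < j" "j - 1 < i" using strict_mono_less[OF x] by auto
    then show "i = j" by simp
  qed (use that in simp)
  have lt: "x (k - 1) < x k" "x k < x (k + 1)" using strict_monoD[OF x] by auto
  show ?thesis
  proof (cases "t = x k")
    case True
    have "(THE i. x (i - 1) \<le> t \<and> t < x i) = k + 1"
      by (rule the) (use True lt in auto)
    then show ?thesis using True lt by (simp add: interp_def)
  next
    case False
    then have "(THE i. x (i - 1) \<le> t \<and> t < x i) = k"
      by (intro the) (use t in \<open>auto simp: elem_def\<close>)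
    then show ?thesis by (simp add: interp_def Let_def)
  qed
qed

lemma interp_P1:
  assumes x: "strict_mono x" and cov: "(\<Union>k. elem x k) = (UNIV :: real set)"
  shows "interp x w \<in> P1 x" and "interp x w (x k) = w k"
proof -
  have aff: "\<exists>a b. \<forall>t\<in>elem x k. interp x w t = a + b * t" for k
  proof -
    let ?b = "(w k - w (k - 1)) / (x k - x (k - 1))"
    have "interp x w t = (w (k - 1) - ?b * x (k - 1)) + ?b * t" if "t \<in> elem x k" for t
      unfolding interp_eq[OF x that] by (simp add: algebra_simps diff_divide_distrib)
    then show ?thesis by blast
  qed
  have cont: "continuous_on (elem x k) (interp x w)" for k
  proof -
    obtain a b where "\<forall>t\<in>elem x k. interp x w t = a + b * t" using aff by blast
    then show ?thesis
      by (subst continuous_on_cong[OF refl, of _ _ "\<lambda>t. a + b * t"])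
        (auto intro!: continuous_intros)
  qed
  have "isCont (interp x w) t" for t
  proof -
    obtain k where k: "x (k - 1) \<le> t" "t < x k" using elem_exists[OF x cov] by blast
    have lt: "x (k - 1 - 1) < x (k - 1)" using strict_monoD[OF x] by simp
    have "continuous_on (elem x (k - 1) \<union> elem x k) (interp x w)"
      by (intro continuous_on_closed_Un cont) (auto simp: elem_def)
    moreover have "{x (k - 1 - 1)<..<x k} \<subseteq> elem x (k - 1) \<union> elem x k"
      by (auto simp: elem_def)
    ultimately have "continuous_on {x (k - 1 - 1)<..<x k} (interp x w)"
      by (rule continuous_on_subset)
    then show ?thesis
      using k lt by (subst (asm) continuous_on_eq_continuous_at) auto
  qed
  then show "interp x w \<in> P1 x"
    using aff by (auto simp: P1_def intro: continuous_at_imp_continuous_on)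
  have "x (k - 1) < x k" using strict_monoD[OF x] by auto
  then show "interp x w (x k) = w k"
    by (subst interp_eq[OF x, of _ k]) (auto simp: elem_def)
qed

lemma lattice_grid:
  assumes "N \<ge> 1"
  shows "strict_mono (lattice N)" and "(\<Union>k. elem (lattice N) k) = UNIV"
proof -
  have e: "eps N > 0" using assms by (simp add: eps_def)
  show "strict_mono (lattice N)" using e by (auto simp: strict_mono_def lattice_def)
  have "t \<in> elem (lattice N) \<lceil>t / eps N\<rceil>" for t
  proof -
    have "of_int \<lceil>t / eps N\<rceil> - 1 < t / eps N" "t / eps N \<le> of_int \<lceil>t / eps N\<rceil>"
      by linarith+
    then have "(of_int \<lceil>t / eps N\<rceil> - 1) * eps N < t" "t \<le> of_int \<lceil>t / eps N\<rceil> * eps N"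
      by (simp_all only: pos_less_divide_eq[OF e] pos_divide_le_eq[OF e])
    then show ?thesis by (simp add: elem_def lattice_def mult.commute)
  qed
  then show "(\<Union>k. elem (lattice N) k) = UNIV" by blast
qed

lemma P1_has_derivative:
  assumes p: "p \<in> P1 x"
  obtains s where "\<And>k t. x (k - 1) < t \<Longrightarrow> t < x k \<Longrightarrow> (p has_real_derivative s k) (at t)"
proof -
  have "\<forall>k. \<exists>a b. \<forall>t\<in>elem x k. p t = a + b * t" using p by (simp add: P1_def)
  then obtain a b where ab: "\<And>k t. t \<in> elem x k \<Longrightarrow> p t = a k + b k * t" by metis
  have "(p has_real_derivative b k) (at t)" if t: "x (k - 1) < t" "t < x k" for k t
  proof -
    have "((\<lambda>t. a k + b k * t) has_real_derivative b k) (at t)"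
      by (auto intro!: derivative_eq_intros)
    then show ?thesis
      by (rule has_field_derivative_transform_within_open[where S = "{x (k - 1)<..<x k}"])
        (use t ab[of _ k] in \<open>auto simp: elem_def\<close>)
  qed
  then show thesis using that by blast
qed

lemma P1_strict_mono:
  assumes x: "strict_mono x" and cov: "(\<Union>k. elem x k) = (UNIV :: real set)"
    and p: "p \<in> P1 x" and pos: "pos_deriv x p"
  shows "strict_mono p"
proof -
  have nn: "t \<notin> range x" if "x (k - 1) < t" "t < x k" for t k
  proof
    assume "t \<in> range x"
    then obtain i where "t = x i" by blast
    then have "k - 1 < i" "i < k" using that strict_mono_less[OF x] by auto
    then show False by simp
  qed
  have el: "p s < p t" if st: "x (k - 1) \<le> s" "s < t" "t \<le> x k" for s t k
  proof (rule DERIV_pos_imp_increasing_open[OF st(2)])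
    obtain d where d: "\<And>k t. x (k - 1) < t \<Longrightarrow> t < x k \<Longrightarrow> (p has_real_derivative d k) (at t)"
      using P1_has_derivative[OF p] by blast
    fix u assume u: "s < u" "u < t"
    then have i: "x (k - 1) < u" "u < x k" using st by auto
    from d[OF i] nn[OF i] pos show "\<exists>y. (p has_real_derivative y) (at u) \<and> y > 0"
      by (metis DERIV_imp_deriv pos_deriv_def)
  next
    show "continuous_on {s..t} p"
      using p by (auto simp: P1_def intro: continuous_on_subset)
  qed
  have chain: "\<forall>s t. x m \<le> s \<longrightarrow> s < t \<longrightarrow> t \<le> x (m + int n) \<longrightarrow> p s < p t" for m n
  proof (induction n)
    case (Suc n)
    show ?case
    proof (intro allI impI)
      fix s t assume st: "x m \<le> s" "s < t" "t \<le> x (m + int (Suc n))"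
      let ?z = "x (m + int n)"
      have z: "?z = x (m + int (Suc n) - 1)" by (simp add: algebra_simps)
      have ih: "p u < p w" if "x m \<le> u" "u < w" "w \<le> ?z" for u w
        using Suc.IH that by blast
      have last: "p u < p w" if "?z \<le> u" "u < w" "w \<le> x (m + int (Suc n))" for u w
        using el that unfolding z by blast
      consider "t \<le> ?z" | "?z \<le> s" | "s < ?z" "?z < t" by linarith
      then show "p s < p t"
      proof cases
        case 1
        then show ?thesis by (intro ih st)
      next
        case 2
        then show ?thesis by (intro last st)
      next
        case 3
        then have "p s < p ?z" "p ?z < p t" using ih[of s ?z] last[of ?z t] st by blast+
        then show ?thesis by (rule less_trans)
      qed
    qed
  qed auto
  show ?thesis
  proof (rule strict_monoI)
    fix s t :: real assume st: "s < t"
    obtain k where k: "x (k - 1) \<le> s" "s < x k" using elem_exists[OF x cov] by blast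
    obtain l where l: "x (l - 1) \<le> t" "t < x l" using elem_exists[OF x cov] by blast
    have "x (k - 1) < x l" using k l st by linarith
    then have "k - 1 < l" using strict_mono_less[OF x] by auto
    then have "k - 1 + int (nat (l - k + 1)) = l" by simp
    then show "p s < p t" using chain[of "k - 1" "nat (l - k + 1)"] k l st by auto
  qed
qed

lemma Dq_pos:
  assumes "strict_mono y" and "bounded \<omega>" and "len \<omega> \<noteq> 0"
  shows "Dq \<omega> y > 0"
proof -
  have "\<exists>a b. a \<in> \<omega> \<and> b \<in> \<omega> \<and> a < b"
  proof (rule ccontr)
    assume "\<not> ?thesis"
    then have "a = b" if "a \<in> \<omega>" "b \<in> \<omega>" for a b using that by (metis linorder_neqE)
    then have "\<omega> = {} \<or> (\<exists>a. \<omega> = {a})" by blast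
    then show False using assms(3) by auto
  qed
  then obtain a b where ab: "a \<in> \<omega>" "b \<in> \<omega>" "a < b" by blast
  have "Inf \<omega> \<le> a" "b \<le> Sup \<omega>"
    using ab assms(2) by (auto intro: cInf_lower cSup_upper bounded_imp_bdd_below bounded_imp_bdd_above)
  then have "Inf \<omega> < Sup \<omega>" using ab by linarith
  then show ?thesis using assms(1) by (simp add: Dq_def strict_mono_def)
qed

lemma Dq_add_scaled: "Dq \<omega> (\<lambda>t. y t + s * v t) = Dq \<omega> y + s * Dq \<omega> v"
  by (simp add: Dq_def add_divide_distrib diff_divide_distrib right_diff_distrib)

lemma C3_pos_deriv:
  assumes "C3_pos \<phi>" "r > 0"
  shows "(\<phi> has_real_derivative deriv \<phi> r) (at r)"
proof -
  have "\<forall>r>0. (deriv ^^ 0) \<phi> differentiable (at r)"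
    using assms(1) unfolding C3_pos_def by (metis zero_less_numeral)
  then show ?thesis using assms(2) by (simp add: DERIV_deriv_iff_real_differentiable)
qed

lemma bond_props:
  assumes "N \<ge> 1" "b \<in> bonds N"
  shows "len (bond N b) = eps N * rb b" "rb b > 0" "eps N > 0" "bounded (bond N b)"
  using assms
  by (auto simp: bonds_def bond_def rb_def lattice_def eps_def algebra_simps divide_simps)

lemma finite_bonds: "finite (bonds N)"
  by (simp add: bonds_def)

lemma DERIV_phi_affine:
  assumes "C3_pos \<phi>" "r > 0" "a > 0"
  shows "((\<lambda>s. \<phi> (r * (a + s * b))) has_real_derivative deriv \<phi> (r * a) * (r * b)) (at 0)"
proof -
  have "((\<lambda>s. r * (a + s * b)) has_real_derivative r * b) (at 0)"
    by (auto intro!: derivative_eq_intros)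
  moreover have "(\<phi> has_real_derivative deriv \<phi> (r * a)) (at (r * (a + 0 * b)))"
    using C3_pos_deriv[OF assms(1), of "r * a"] assms by simp
  ultimately show ?thesis using DERIV_chain2 by fast
qed

text \<open>The closed formula \<open>dE_a\<close> is the directional derivative of the energy.\<close>

lemma E_a_has_derivative:
  assumes "N \<ge> 1" "C3_pos \<phi>" "strict_mono y"
  shows "((\<lambda>s. E_a N \<phi> (\<lambda>t. y t + s * v t)) has_real_derivative dE_a N \<phi> y v) (at 0)"
  unfolding E_a_def dE_a_def Dq_add_scaled
proof (intro DERIV_cmult DERIV_sum DERIV_phi_affine assms(2))
  fix b assume b: "b \<in> bonds N"
  show "rb b > 0" using bond_props[OF assms(1) b] by simp
  show "Dq (bond N b) y > 0"
    using bond_props[OF assms(1) b] by (intro Dq_pos assms(3)) auto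
qed

lemma set_lint_step:
  assumes x: "strict_mono x" and cov: "(\<Union>k. elem x k) = (UNIV :: real set)"
    and S: "bounded S" "S \<in> sets borel"
  shows "\<exists>J. finite J \<and> (\<forall>g c. (\<forall>k s. x (k - 1) < s \<longrightarrow> s < x k \<longrightarrow> g s = (c k :: real)) \<longrightarrow>
      (LINT s:S|lborel. g s) = (\<Sum>k\<in>J. c k * len (S \<inter> {x (k - 1)<..<x k})))"
proof -
  obtain B where B: "\<And>s. s \<in> S \<Longrightarrow> \<bar>s\<bar> \<le> B" using S(1) by (auto simp: bounded_iff)
  obtain k where k: "x (k - 1) \<le> - B" using elem_exists[OF x cov] by blast
  obtain l where l: "B < x l" using elem_exists[OF x cov] by blast
  let ?J = "{k..l}" and ?O = "\<lambda>k. S \<inter> {x (k - 1)<..<x k}"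
  have uniq: "i = j" if "x (i - 1) < s" "s < x i" "x (j - 1) < s" "s < x j" for i j s
  proof -
    have "x (i - 1) < x j" "x (j - 1) < x i" using that by linarith+
    then have "i - 1 < j" "j - 1 < i" using strict_mono_less[OF x] by auto
    then show ?thesis by simp
  qed
  show ?thesis
  proof (intro exI[of _ ?J] conjI allI impI)
    fix g :: "real \<Rightarrow> real" and c
    assume "\<forall>k s. x (k - 1) < s \<longrightarrow> s < x k \<longrightarrow> g s = c k"
    then have g: "\<And>k s. x (k - 1) < s \<Longrightarrow> s < x k \<Longrightarrow> g s = c k" by blast
    have fin: "emeasure lborel (?O i) < \<infinity>" for i
      by (intro emeasure_bounded_finite bounded_Int) (use S in auto)
    have meas: "?O i \<in> sets lborel" for i using S by auto
    have eq: "indicator S s *\<^sub>R g s = (\<Sum>i\<in>?J. c i * indicator (?O i) s)" if s: "s \<notin> range x" for s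
    proof -
      obtain j where "x (j - 1) \<le> s" "s < x j" using elem_exists[OF x cov] by blast
      then have j: "x (j - 1) < s" "s < x j" using s by (auto simp: order.order_iff_strict)
      have ind: "indicator (?O i) s = (if i = j then indicator S s else (0::real))" for i
      proof (cases "i = j")
        case False
        then have "s \<notin> ?O i" using uniq[of i s j] j by auto
        then show ?thesis using False by simp
      qed (use j in \<open>simp add: indicator_def\<close>)
      have "j \<in> ?J" if "s \<in> S"
      proof -
        have "x (k - 1) < x j" "x (j - 1) < x l" using B[OF that] k l j by (auto simp: abs_le_iff)
        then have "k - 1 < j" "j - 1 < l" using strict_mono_less[OF x] by auto
        then show ?thesis by simp
      qed
      then show ?thesis
        unfolding ind using g[OF j] by (cases "s \<in> S") (simp_all add: if_distrib cong: if_cong)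
    qed
    have "(LINT s:S|lborel. g s) = (LINT s|lborel. (\<Sum>i\<in>?J. c i * indicator (?O i) s))"
      unfolding set_lebesgue_integral_def
      by (rule integral_discrete_difference[where X = "range x"]) (use eq in auto)
    also have "\<dots> = (\<Sum>i\<in>?J. c i * len (?O i))"
    proof (subst Bochner_Integration.integral_sum)
      show "integrable lborel (\<lambda>s. c i * indicator (?O i) s)" for i
        by (intro integrable_mult_right integrable_real_indicator meas fin)
    qed (use meas in simp)
    finally show "(LINT s:S|lborel. g s) = (\<Sum>i\<in>?J. c i * len (?O i))" .
  qed simp
qed

lemma per_borel: "per (Om_c La Ra) \<in> sets borel"
proof -
  have "per (Om_c La Ra) = (\<Union>m::int. (\<lambda>t. t - real_of_int m) -` Om_c La Ra)"
  proof (intro equalityI subsetI)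
    fix s assume "s \<in> per (Om_c La Ra)"
    then obtain t m where "t \<in> Om_c La Ra" "s = t + real_of_int m" by (auto simp: per_def)
    then have "s - real_of_int m \<in> Om_c La Ra" by simp
    then show "s \<in> (\<Union>m::int. (\<lambda>t. t - real_of_int m) -` Om_c La Ra)" by blast
  next
    fix s assume "s \<in> (\<Union>m::int. (\<lambda>t. t - real_of_int m) -` Om_c La Ra)"
    then obtain m where "s - real_of_int m \<in> Om_c La Ra" by blast
    moreover have "s = (s - real_of_int m) + real_of_int m" by simp
    ultimately show "s \<in> per (Om_c La Ra)" unfolding per_def by blast
  qed
  also have "\<dots> \<in> sets borel"
  proof (rule sets.countable_UN'')
    fix m :: int
    have "Om_c La Ra \<in> sets borel" by (auto simp: Om_c_def Om_a_def)
    then show "(\<lambda>t. t - real_of_int m) -` Om_c La Ra \<in> sets borel"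
      using measurable_sets_borel[of "\<lambda>t. t - real_of_int m" borel "Om_c La Ra"] by simp
  qed simp
  finally show ?thesis .
qed

text \<open>The closed formula \<open>dE_qc\<close> is the directional derivative of the energy.\<close>

lemma E_qc_has_derivative:
  assumes N: "N \<ge> 1" and phi: "C3_pos \<phi>" and mesh: "is_mesh N La Ra K x"
    and y: "y \<in> P1 x" and pos: "pos_deriv x y" and v: "v \<in> P1 x"
  shows "((\<lambda>s. E_qc N \<phi> La Ra (\<lambda>t. y t + s * v t)) has_real_derivative dE_qc N \<phi> La Ra y v) (at 0)"
proof -
  have x: "strict_mono x" and cov: "(\<Union>k. elem x k) = UNIV"
    using mesh by (auto simp: is_mesh_def)
  have mono: "strict_mono y" by (rule P1_strict_mono[OF x cov y pos])
  obtain a where a: "\<And>k t. x (k - 1) < t \<Longrightarrow> t < x k \<Longrightarrow> (y has_real_derivative a k) (at t)"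
    using P1_has_derivative[OF y] by blast
  obtain d where d: "\<And>k t. x (k - 1) < t \<Longrightarrow> t < x k \<Longrightarrow> (v has_real_derivative d k) (at t)"
    using P1_has_derivative[OF v] by blast
  have apos: "a k > 0" for k
  proof -
    have lt: "x (k - 1) < x k" using strict_monoD[OF x] by simp
    let ?t = "(x (k - 1) + x k) / 2"
    have t: "x (k - 1) < ?t" "?t < x k" using lt by auto
    have "?t \<notin> range x"
    proof
      assume "?t \<in> range x"
      then obtain i where "?t = x i" by blast
      then have "k - 1 < i" "i < k" using t strict_mono_less[OF x] by auto
      then show False by simp
    qed
    then show ?thesis using a[OF t] pos by (metis DERIV_imp_deriv pos_deriv_def)
  qed
  have A: "((\<lambda>s. len (b_a N La Ra b) / len (bond N b) * \<phi> (rb b * Dq (b_a N La Ra b) (\<lambda>t. y t + s * v t)))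
      has_real_derivative len (b_a N La Ra b) *
        deriv \<phi> (rb b * Dq (b_a N La Ra b) y) * Dq (b_a N La Ra b) v / eps N) (at 0)"
    if b: "b \<in> bonds N" for b
  proof (cases "len (b_a N La Ra b) = 0")
    case False
    note bp = bond_props[OF N b]
    have "Dq (b_a N La Ra b) y > 0" by (intro Dq_pos mono False bounded_Int) (use bp in auto)
    from DERIV_cmult[OF DERIV_phi_affine[OF phi bp(2) this, of "Dq (b_a N La Ra b) v"],
        of "len (b_a N La Ra b) / len (bond N b)"]
    show ?thesis unfolding Dq_add_scaled bp(1) using bp(2,3) by (simp add: field_simps)
  qed simp
  have C: "((\<lambda>s. 1 / len (bond N b) * (LINT t:b_c N La Ra b|lborel. \<phi> (rb b * deriv (\<lambda>t. y t + s * v t) t)))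
      has_real_derivative (LINT t:b_c N La Ra b|lborel. deriv \<phi> (rb b * deriv y t) * deriv v t) / eps N) (at 0)"
    if b: "b \<in> bonds N" for b
  proof -
    note bp = bond_props[OF N b]
    have "bounded (b_c N La Ra b)" "b_c N La Ra b \<in> sets borel"
      using bp per_borel by (auto simp: bond_def)
    from set_lint_step[OF x cov this] obtain J where
      J: "\<forall>g c. (\<forall>k s. x (k - 1) < s \<longrightarrow> s < x k \<longrightarrow> g s = (c k :: real)) \<longrightarrow>
        (LINT s:b_c N La Ra b|lborel. g s) = (\<Sum>k\<in>J. c k * len (b_c N La Ra b \<inter> {x (k - 1)<..<x k}))"
      by blast
    have 1: "(LINT t:b_c N La Ra b|lborel. \<phi> (rb b * deriv (\<lambda>t. y t + s * v t) t)) =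
        (\<Sum>k\<in>J. \<phi> (rb b * (a k + s * d k)) * len (b_c N La Ra b \<inter> {x (k - 1)<..<x k}))" for s
    proof (rule J[rule_format])
      fix k t assume t: "x (k - 1) < t" "t < x k"
      have "deriv (\<lambda>t. y t + s * v t) t = a k + s * d k"
        by (intro DERIV_imp_deriv DERIV_add DERIV_cmult a d t)
      then show "\<phi> (rb b * deriv (\<lambda>t. y t + s * v t) t) = \<phi> (rb b * (a k + s * d k))" by simp
    qed
    have 2: "(LINT t:b_c N La Ra b|lborel. deriv \<phi> (rb b * deriv y t) * deriv v t) =
        (\<Sum>k\<in>J. (deriv \<phi> (rb b * a k) * d k) * len (b_c N La Ra b \<inter> {x (k - 1)<..<x k}))"
    proof (rule J[rule_format])
      fix k t assume t: "x (k - 1) < t" "t < x k"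
      show "deriv \<phi> (rb b * deriv y t) * deriv v t = deriv \<phi> (rb b * a k) * d k"
        using a[OF t] d[OF t] by (simp add: DERIV_imp_deriv)
    qed
    have "((\<lambda>s. 1 / len (bond N b) * (\<Sum>k\<in>J. \<phi> (rb b * (a k + s * d k)) * len (b_c N La Ra b \<inter> {x (k - 1)<..<x k})))
      has_real_derivative 1 / len (bond N b) *
        (\<Sum>k\<in>J. (deriv \<phi> (rb b * a k) * (rb b * d k)) * len (b_c N La Ra b \<inter> {x (k - 1)<..<x k}))) (at 0)"
      by (intro DERIV_cmult DERIV_sum DERIV_cmult_right DERIV_phi_affine phi bp apos)
    then show ?thesis
      unfolding 1 2 bp(1) using bp(2,3)
      by (simp add: sum_distrib_left sum_divide_distrib field_simps)
  qed
  have "((\<lambda>s. E_qc N \<phi> La Ra (\<lambda>t. y t + s * v t)) has_real_derivative eps N * (\<Sum>b\<in>bonds N.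
      len (b_a N La Ra b) * deriv \<phi> (rb b * Dq (b_a N La Ra b) y) * Dq (b_a N La Ra b) v / eps N
    + (LINT t:b_c N La Ra b|lborel. deriv \<phi> (rb b * deriv y t) * deriv v t) / eps N)) (at 0)"
    unfolding E_qc_def by (intro DERIV_cmult DERIV_sum DERIV_add A C)
  moreover have "eps N \<noteq> 0" using N by (simp add: eps_def)
  ultimately show ?thesis
    unfolding dE_qc_def by (simp add: sum.distrib sum_divide_distrib[symmetric] distrib_left)
qed

end

theory Submission
  imports Defs
begin

text \<open>The nodal interpolant in the quasicontinuum derivative may be replaced by the test function
  itself, so the residual is a sum over bonds of integrals of a stress error times the derivative of
  the test function. The stress error vanishes on every bond without a continuum node: such a bond
  lies in the atomistic region or inside one mesh element. The constant \<open>3 = 1 + 2\<close> counts how often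
  the bonds of both kinds cover a period.\<close>

section \<open>Locally bounded functions\<close>

text \<open>Mesh nodes in the continuum region need not be lattice points, so on a single bond
  \<open>I_h v\<close> and \<open>v\<close> may contribute differently to the quasicontinuum
  derivative; only the sum over all bonds of one length can be compared. That sum is a multiple of
  an integral over one period, and a period may be cut at mesh nodes instead of lattice points. On a
  mesh element in the continuum region the stress \<phi>'(r_b y_h') is constant and factors out,
  while the difference of the two functions vanishes at both ends. The atomistic terms do agree bond
  by bond, because (T2)-(T4) force each \<open>b_a\<close> to be empty or an interval between two
  nodes. The exchange is exact: no interpolation estimate enters, so the constant carries no mesh
  size.\<close>

definition loc_bdd :: "(real \<Rightarrow> real) \<Rightarrow> bool" where
  "loc_bdd f \<longleftrightarrow> f \<in> borel_measurable borel \<and> (\<forall>S. bounded S \<longrightarrow> bounded (f ` S))"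

lemma loc_bddI:
  assumes "f \<in> borel_measurable borel" "\<And>S. bounded S \<Longrightarrow> bounded (f ` S)"
  shows "loc_bdd f"
  using assms by (simp add: loc_bdd_def)

lemma loc_bddD:
  assumes "loc_bdd f"
  shows "f \<in> borel_measurable borel" "bounded S \<Longrightarrow> bounded (f ` S)"
  using assms by (simp_all add: loc_bdd_def)

text \<open>All integrands are built from derivatives of piecewise affine functions. Local
  boundedness, unlike integrability, is stable under products, so every integrability side condition
  reduces to the closure rules that follow.\<close>

lemma loc_bdd_set_integrable:
  assumes f: "loc_bdd f" and S: "bounded S" "S \<in> sets borel"
  shows "set_integrable lborel S f"
proof -
  obtain B where B: "\<And>t. t \<in> S \<Longrightarrow> \<bar>f t\<bar> \<le> B"
    using loc_bddD(2)[OF f S(1)] by (auto simp: bounded_iff)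
  show ?thesis
    unfolding set_integrable_def
  proof (rule integrableI_bounded_set[where A = S and B = B])
    note loc_bddD(1)[OF f, measurable] S(2)[measurable]
    show "(\<lambda>t. indicator S t *\<^sub>R f t) \<in> borel_measurable lborel" by measurable
    show "emeasure lborel S < \<infinity>" by (rule emeasure_bounded_finite[OF S(1)])
  qed (use S B in auto)
qed

lemma loc_bdd_Ioo:
  assumes "loc_bdd f"
  shows "set_integrable lborel {a<..<b::real} f"
  by (rule loc_bdd_set_integrable[OF assms]) auto

lemma loc_bdd_const: "loc_bdd (\<lambda>t. c)"
  by (rule loc_bddI) (auto intro: bounded_subset[of "{c}"])

lemma loc_bdd_add:
  assumes "loc_bdd f" "loc_bdd g"
  shows "loc_bdd (\<lambda>t. f t + g t)"
  by (rule loc_bddI) (intro borel_measurable_add bounded_plus_comp loc_bddD assms; assumption)+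

lemma loc_bdd_diff:
  assumes "loc_bdd f" "loc_bdd g"
  shows "loc_bdd (\<lambda>t. f t - g t)"
  by (rule loc_bddI) (intro borel_measurable_diff bounded_minus_comp loc_bddD assms; assumption)+

lemma loc_bdd_mult:
  assumes "loc_bdd f" "loc_bdd g"
  shows "loc_bdd (\<lambda>t. f t * g t)"
proof -
  have "bounded ((\<lambda>t. f t * g t) ` S)" if S: "bounded S" for S
  proof -
    obtain A B where "\<And>t. t \<in> S \<Longrightarrow> \<bar>f t\<bar> \<le> A" "\<And>t. t \<in> S \<Longrightarrow> \<bar>g t\<bar> \<le> B"
      using loc_bddD(2)[OF assms(1) S] loc_bddD(2)[OF assms(2) S] by (auto simp: bounded_iff)
    then have "\<bar>f t * g t\<bar> \<le> A * B" if "t \<in> S" for t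
      unfolding abs_mult using that by (intro mult_mono) (auto intro: order_trans[OF abs_ge_zero])
    then show ?thesis by (auto simp: bounded_iff)
  qed
  with assms show ?thesis by (auto intro!: loc_bddI borel_measurable_times dest: loc_bddD(1))
qed

lemma loc_bdd_power2:
  assumes "loc_bdd f"
  shows "loc_bdd (\<lambda>t. (f t)\<^sup>2)"
  unfolding power2_eq_square by (intro loc_bdd_mult assms)

lemma loc_bdd_if:
  assumes "S \<in> sets borel" "loc_bdd f" "loc_bdd g"
  shows "loc_bdd (\<lambda>t. if t \<in> S then f t else g t)"
proof -
  have "bounded ((\<lambda>t. if t \<in> S then f t else g t) ` A)" if "bounded A" for A
  proof (rule bounded_subset)
    show "bounded (f ` A \<union> g ` A)" using loc_bddD(2) assms that by simp
  qed auto
  moreover have "(\<lambda>t. if t \<in> S then f t else g t) \<in> borel_measurable borel"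
    using assms by (intro measurable_If_set loc_bddD(1)) auto
  ultimately show ?thesis by (simp add: loc_bdd_def)
qed

text \<open>Additivity of the signed integral from 0. With \<open>P\<close>, sums of integrals over
  lattice cells or mesh elements telescope.\<close>

lemma loc_bdd_primitive:
  assumes f: "loc_bdd f"
  obtains P where "\<And>a b. a \<le> b \<Longrightarrow> (LINT t:{a<..<b}|lborel. f t) = P b - P a"
proof
  fix a b :: real assume ab: "a \<le> b"
  have "interval_lebesgue_integrable lborel (min (ereal 0) (min (ereal a) (ereal b)))
      (max (ereal 0) (max (ereal a) (ereal b))) f"
    unfolding interval_lebesgue_integrable_def
    using loc_bdd_Ioo[OF f] by (auto simp: einterval_eq min_def max_def)
  from interval_integral_sum[OF this]
  have "(LBINT t=ereal 0..ereal a. f t) + (LBINT t=ereal a..ereal b. f t) = (LBINT t=ereal 0..ereal b. f t)" .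
  moreover have "(LBINT t=ereal a..ereal b. f t) = (LINT t:{a<..<b}|lborel. f t)"
    using ab by (simp add: interval_lebesgue_integral_def einterval_eq)
  ultimately show "(LINT t:{a<..<b}|lborel. f t) =
      (LBINT t=ereal 0..ereal b. f t) - (LBINT t=ereal 0..ereal a. f t)" by simp
qed

lemma periodic_primitive:
  assumes f: "loc_bdd f" and per: "\<And>t. f (t + 1) = f t"
  obtains P where "\<And>a b. a \<le> b \<Longrightarrow> (LINT t:{a<..<b}|lborel. f t) = P b - P a"
    and "\<And>a. P (a + 1) - P a = (LINT t:{-1/2<..<1/2}|lborel. f t)"
proof -
  obtain P where P: "\<And>a b. a \<le> b \<Longrightarrow> (LINT t:{a<..<b}|lborel. f t) = P b - P a"
    using loc_bdd_primitive[OF f] by blast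
  have shift: "P (b + 1) - P (a + 1) = P b - P a" if "a \<le> b" for a b
  proof -
    have "(LINT t:{a + 1<..<b + 1}|lborel. f t) = (LINT t:{a<..<b}|lborel. f t)"
      unfolding set_lebesgue_integral_def
      by (subst lborel_integral_real_affine[of 1 _ 1])
        (auto simp: per add.commute[of 1] indicator_def intro!: Bochner_Integration.integral_cong)
    then show ?thesis using P that by simp
  qed
  \<comment> \<open>By \<open>shift\<close>, the increments of \<open>P\<close> from
    \<open>a\<close> to -1/2 and from \<open>a + 1\<close> to 1/2 agree; the case split only orients
    the interval.\<close>
  have "P (a + 1) - P a = P (1/2) - P (-1/2)" for a
  proof (cases "a \<le> -1/2")
    case True
    from shift[OF this] show ?thesis by simp
  next
    case False
    then have "-1/2 \<le> a" by simp
    from shift[OF this] show ?thesis by simp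
  qed
  then show thesis using that P by simp
qed

section \<open>Step functions on a grid\<close>

text \<open>Instantiated twice: with the mesh for \<open>y\<close> and the interpolant, and with the
  lattice for the test function.\<close>

locale grid =
  fixes x :: "int \<Rightarrow> real"
  assumes mono: "strict_mono x" and cover: "(\<Union>k. elem x k) = UNIV"
begin

text \<open>Values at the nodes are left free, since \<open>deriv\<close> has an unspecified value
  at a kink.\<close>

definition step_fun :: "(real \<Rightarrow> real) \<Rightarrow> bool" where
  "step_fun f \<longleftrightarrow> (\<forall>k. \<exists>c. \<forall>t. x (k - 1) < t \<longrightarrow> t < x k \<longrightarrow> f t = c)"

lemma open_elem_cases:
  obtains k where "t = x k" | k where "x (k - 1) < t" "t < x k"
  using elem_exists[OF mono cover, of t] by (metis less_eq_real_def)

lemma bounded_subset_grid: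
  assumes "bounded S"
  obtains m n where "S \<subseteq> {x m<..<x n}"
proof -
  obtain B where B: "\<And>s. s \<in> S \<Longrightarrow> \<bar>s\<bar> \<le> B" using assms by (auto simp: bounded_iff)
  obtain m where "x (m - 1) \<le> - B - 1" using elem_exists[OF mono cover] by blast
  moreover obtain n where "B < x n" using elem_exists[OF mono cover] by blast
  ultimately have "S \<subseteq> {x (m - 1)<..<x n}" using B by (force simp: abs_le_iff)
  then show thesis using that by blast
qed

lemma finite_nodes:
  assumes "bounded S"
  shows "finite (S \<inter> range x)"
proof -
  obtain m n where "S \<subseteq> {x m<..<x n}" using bounded_subset_grid[OF assms] .
  then have "S \<inter> range x \<subseteq> x ` {m..n}"
    by (auto simp: strict_mono_less[OF mono] intro!: imageI)
  then show ?thesis by (rule finite_subset) simp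
qed

text \<open>A bounded set meets finitely many elements and nodes, so only finitely many values occur
  on it. Measurability comes from the countable partition into open elements and single
  nodes.\<close>

lemma step_fun_loc_bdd:
  assumes f: "step_fun f"
  shows "loc_bdd f"
proof (rule loc_bddI)
  obtain c where c: "\<And>k t. x (k - 1) < t \<Longrightarrow> t < x k \<Longrightarrow> f t = c k"
    using f unfolding step_fun_def by metis
  let ?C = "range (\<lambda>k. {x (k - 1)<..<x k}) \<union> range (\<lambda>k. {x k})"
  show "f \<in> borel_measurable borel"
  proof (rule measurable_piecewise_restrict[where C = ?C])
    show "space borel \<subseteq> \<Union>?C"
    proof
      fix t :: real
      show "t \<in> \<Union>?C" by (rule open_elem_cases[of t]) auto
    qed
    fix A assume A: "A \<in> ?C"
    then show "A \<inter> space borel \<in> sets borel" by auto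
    from A obtain d where "\<And>t. t \<in> A \<Longrightarrow> f t = d" using c by force
    then show "f \<in> borel_measurable (restrict_space borel A)"
      by (subst measurable_cong[where g = "\<lambda>_. d"]) (auto simp: space_restrict_space)
  qed auto
  fix S :: "real set" assume "bounded S"
  then obtain m n where mn: "S \<subseteq> {x m<..<x n}" by (rule bounded_subset_grid)
  have "f t \<in> c ` {m..n} \<union> f ` x ` {m..n}" if "t \<in> S" for t
  proof (rule open_elem_cases[of t])
    fix k assume "t = x k"
    then have "x m < x k" "x k < x n" using mn that by fastforce+
    then have "k \<in> {m..n}" using strict_mono_less[OF mono] by auto
    then show ?thesis using \<open>t = x k\<close> by blast
  next
    fix k assume k: "x (k - 1) < t" "t < x k"
    then have "x m < x k" "x (k - 1) < x n" using mn that by fastforce+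
    then have "k \<in> {m..n}" using strict_mono_less[OF mono] by auto
    then show ?thesis using c[OF k] by blast
  qed
  then have "f ` S \<subseteq> c ` {m..n} \<union> f ` x ` {m..n}" by blast
  then show "bounded (f ` S)" by (rule bounded_subset[rotated]) (intro finite_imp_bounded, simp)
qed

text \<open>With \<open>g\<close> arbitrary, this covers the stress
  \<open>deriv \<phi> (r * deriv y t)\<close> as a function of \<open>t\<close>.\<close>

lemma step_fun_comp:
  assumes "step_fun f"
  shows "step_fun (\<lambda>t. g (f t))"
  using assms unfolding step_fun_def by metis

lemma step_fun_deriv_P1:
  assumes "p \<in> P1 x"
  shows "step_fun (deriv p)"
  using P1_has_derivative[OF assms] unfolding step_fun_def by (metis DERIV_imp_deriv)

text \<open>The end points are arbitrary because lattice functions are also integrated over mesh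
  elements. The fundamental theorem tolerates the finitely many kinks in between, as
  \<open>p\<close> is continuous.\<close>

lemma integral_deriv_P1:
  assumes p: "p \<in> P1 x" and ab: "a \<le> b"
  shows "(LINT t:{a<..<b}|lborel. deriv p t) = p b - p a"
proof -
  obtain s where s: "\<And>k t. x (k - 1) < t \<Longrightarrow> t < x k \<Longrightarrow> (p has_real_derivative s k) (at t)"
    using P1_has_derivative[OF p] by blast
  have der: "(p has_vector_derivative deriv p t) (at t)" if "t \<notin> range x" for t
  proof (rule open_elem_cases[of t])
    fix k assume "x (k - 1) < t" "t < x k"
    from s[OF this] show ?thesis
      by (metis DERIV_imp_deriv has_real_derivative_iff_has_vector_derivative)
  qed (use that in auto)
  have "(deriv p has_integral (p b - p a)) {a..b}"
  proof (rule fundamental_theorem_of_calculus_interior_strong[where S = "{a<..<b} \<inter> range x"])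
    show "continuous_on {a..b} p" using p by (auto simp: P1_def intro: continuous_on_subset)
  qed (use ab der in \<open>auto intro: finite_nodes\<close>)
  then have "integral {a<..<b} (deriv p) = p b - p a"
    using integral_open_interval_real[of a b "deriv p"] by (auto simp: integral_unique)
  moreover have "set_integrable lborel {a<..<b} (deriv p)"
    by (intro loc_bdd_Ioo step_fun_loc_bdd step_fun_deriv_P1 p)
  ultimately show ?thesis by (simp add: set_borel_integral_eq_integral)
qed

lemma interp_periodic:
  assumes xp: "\<And>k. x (k + m) = x k + 1" and w: "\<And>k. w (k + m) = w k"
  shows "interp x w (t + 1) = interp x w t"
proof -
  obtain k where k: "t \<in> elem x k" using cover by blast
  have "k + m - 1 = (k - 1) + m" by simp
  note eq = xp[of "k - 1", folded this] w[of "k - 1", folded this] xp[of k] w[of k]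
  have "t + 1 \<in> elem x (k + m)" using k eq by (simp add: elem_def)
  from interp_eq[OF mono this] interp_eq[OF mono k] eq show ?thesis by simp
qed

end

section \<open>Periodic shifts and summation over the bonds of one period\<close>

lemma deriv_shift:
  fixes f :: "real \<Rightarrow> real"
  assumes "\<And>t. f (t + 1) = f t + c"
  shows "deriv f (t + 1) = deriv f t"
proof -
  \<comment> \<open>An equivalence for every \<open>D\<close> makes the unspecified values of
    \<open>deriv\<close> at kinks agree too. The constant \<open>c\<close> admits \<open>y\<close>,
    which is periodic only up to the increment \<open>F\<close>.\<close>
  have "(f has_real_derivative D) (at (t + 1)) \<longleftrightarrow> (f has_real_derivative D) (at t)" for D
  proof -
    have "(f has_real_derivative D) (at (t + 1)) \<longleftrightarrow> ((\<lambda>s. f s + c) has_real_derivative D) (at t)"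
      by (simp add: DERIV_shift assms)
    also have "\<dots> \<longleftrightarrow> (f has_real_derivative D) (at t)"
      using DERIV_diff[OF _ DERIV_const[of c], of "\<lambda>s. f s + c" D t] DERIV_add[OF _ DERIV_const[of c], of f D t]
      by auto
    finally show ?thesis .
  qed
  then show ?thesis by (simp add: deriv_def)
qed

lemma sum_telescope_int:
  fixes f :: "int \<Rightarrow> real"
  shows "(\<Sum>l\<in>{a + 1..a + int n}. f (l + 1) - f l) = f (a + int n + 1) - f (a + 1)"
proof (induction n)
  case (Suc n)
  have "{a + 1..a + int (Suc n)} = insert (a + int n + 1) {a + 1..a + int n}" by auto
  then show ?case using Suc by (simp add: add.commute add.left_commute)
qed simp

text \<open>Bonds of length two overlap and reach beyond the period, so the count rests on
  periodicity. The integrand may depend on the bond length, as the continuum stress does through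
  \<open>rb\<close>.\<close>

lemma sum_bonds_periodic:
  assumes N: "N \<ge> 1" and f: "\<And>j. loc_bdd (f j)" and per: "\<And>j t. f j (t + 1) = f j t"
  shows "(\<Sum>b\<in>bonds N. LINT t:bond N b|lborel. f (snd b) t) =
    (LINT t:{-1/2<..<1/2}|lborel. f 1 t) + 2 * (LINT t:{-1/2<..<1/2}|lborel. f 2 t)"
proof -
  let ?L = "{- int N + 1..int N}"
  have lat: "lattice N (l + 2 * int N) = lattice N l + 1" for l
    using N by (simp add: lattice_def eps_def field_simps)
  have le: "lattice N l \<le> lattice N (l + 1)" "lattice N l \<le> lattice N (l + 2)" for l
    by (simp_all add: lattice_def eps_def divide_right_mono)
  have tel: "(\<Sum>l\<in>?L. g (l + 1) - g l) = g (int N + 1) - g (- int N + 1)" for g :: "int \<Rightarrow> real"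
    using sum_telescope_int[of g "- int N" "2 * N"] by simp
  have ends: "lattice N (int N + 1) = lattice N (- int N + 1) + 1"
    "lattice N (int N + 2) = lattice N (- int N + 2) + 1"
    using lat[of "- int N + 1"] lat[of "- int N + 2"] by (simp_all add: algebra_simps)
  obtain P where P: "\<And>a b. a \<le> b \<Longrightarrow> (LINT t:{a<..<b}|lborel. f 1 t) = P b - P a"
    "\<And>a. P (a + 1) - P a = (LINT t:{-1/2<..<1/2}|lborel. f 1 t)"
    using periodic_primitive[OF f[of 1] per[of 1]] by blast
  obtain Q where Q: "\<And>a b. a \<le> b \<Longrightarrow> (LINT t:{a<..<b}|lborel. f 2 t) = Q b - Q a"
    "\<And>a. Q (a + 1) - Q a = (LINT t:{-1/2<..<1/2}|lborel. f 2 t)"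
    using periodic_primitive[OF f[of 2] per[of 2]] by blast
  have "(\<Sum>b\<in>bonds N. LINT t:bond N b|lborel. f (snd b) t) =
      (\<Sum>l\<in>?L. (LINT t:bond N (l, 1)|lborel. f 1 t) + (LINT t:bond N (l, 2)|lborel. f 2 t))"
    unfolding bonds_def by (subst sum.cartesian_product[symmetric, of "\<lambda>l j. LINT t:bond N (l, j)|lborel. f j t", simplified case_prod_unfold prod.collapse]) simp
  \<comment> \<open>Each bond of length two is cut at its middle lattice point, giving two
    telescoping sums with shifted starting points; each of them spans exactly one period.\<close>
  also have "\<dots> = (\<Sum>l\<in>?L. P (lattice N (l + 1)) - P (lattice N l)) +
      ((\<Sum>l\<in>?L. Q (lattice N (l + 1 + 1)) - Q (lattice N (l + 1))) +
       (\<Sum>l\<in>?L. Q (lattice N (l + 1)) - Q (lattice N l)))"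
    unfolding sum.distrib[symmetric] by (rule sum.cong) (auto simp: bond_def P Q le add.commute)
  also have "\<dots> = (P (lattice N (- int N + 1) + 1) - P (lattice N (- int N + 1))) +
      ((Q (lattice N (- int N + 2) + 1) - Q (lattice N (- int N + 2))) +
       (Q (lattice N (- int N + 1) + 1) - Q (lattice N (- int N + 1))))"
    using tel[of "\<lambda>l. P (lattice N l)"] tel[of "\<lambda>l. Q (lattice N (l + 1))"] tel[of "\<lambda>l. Q (lattice N l)"]
    by (simp add: ends add.assoc)
  finally show ?thesis using P(2) Q(2) by simp
qed

section \<open>Geometry of the coupled mesh\<close>

locale qc_mesh =
  fixes N K :: nat and La Ra :: real and x :: "int \<Rightarrow> real"
  assumes N: "N \<ge> 1" and La: "-1/2 < La" and LaRa: "La < Ra" and Ra: "Ra < 1/2"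
    and mesh: "is_mesh N La Ra K x"
begin

sublocale grid x
  using mesh by unfold_locales (auto simp: is_mesh_def)

sublocale lat: grid "lattice N"
  using lattice_grid[OF N] by unfold_locales

lemma mesh_periodic: "x (k + int K) = x k + 1"
  using mesh by (simp add: is_mesh_def)

lemma lattice_shift: "lattice N (l + 2 * int N * m) = lattice N l + of_int m"
  using N by (simp add: lattice_def eps_def field_simps)

lemma node_shift: "x (k + int K * m) = x k + of_int m"
proof (induction m rule: int_induct[where k = 0])
  case (step1 m)
  then show ?case using mesh_periodic[of "k + int K * m"] by (simp add: algebra_simps)
next
  case (step2 m)
  then show ?case using mesh_periodic[of "k + int K * (m - 1)"] by (simp add: algebra_simps)
qed simp

lemma range_node_shift:
  assumes "t \<in> range x"
  shows "t + of_int m \<in> range x"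
  using assms node_shift by (metis imageE rangeI)

lemma interfaces: "La \<in> range x" "Ra \<in> range x"
  using mesh by (auto simp: is_mesh_def)

lemma per_Om_a: "t \<in> per (Om_a La Ra) \<longleftrightarrow> (\<exists>m::int. La + of_int m < t \<and> t < Ra + of_int m)"
proof
  assume "\<exists>m::int. La + of_int m < t \<and> t < Ra + of_int m"
  then obtain m :: int where "La + of_int m < t" "t < Ra + of_int m" by blast
  then have "t - of_int m \<in> Om_a La Ra" by (auto simp: Om_a_def)
  moreover have "t = (t - of_int m) + of_int m" by simp
  ultimately show "t \<in> per (Om_a La Ra)" unfolding per_def by blast
next
  assume "t \<in> per (Om_a La Ra)"
  then obtain s and m :: int where "t = s + of_int m" "La < s" "s < Ra" by (auto simp: per_def Om_a_def)
  then show "\<exists>m::int. La + of_int m < t \<and> t < Ra + of_int m" by (intro exI[of _ m]) simp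
qed

lemma per_Om_a_shift: "t + 1 \<in> per (Om_a La Ra) \<longleftrightarrow> t \<in> per (Om_a La Ra)"
proof
  assume "t + 1 \<in> per (Om_a La Ra)"
  then obtain m :: int where "La + of_int m < t + 1 \<and> t + 1 < Ra + of_int m" by (auto simp: per_Om_a)
  then show "t \<in> per (Om_a La Ra)" unfolding per_Om_a by (intro exI[of _ "m - 1"]) auto
next
  assume "t \<in> per (Om_a La Ra)"
  then obtain m :: int where "La + of_int m < t \<and> t < Ra + of_int m" by (auto simp: per_Om_a)
  then show "t + 1 \<in> per (Om_a La Ra)" unfolding per_Om_a by (intro exI[of _ "m + 1"]) auto
qed

text \<open>The atomistic interval lies strictly inside the period, so a point of one of its copies
  cannot also come from the closed period \<open>[-1/2, 1/2]\<close> under a different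
  shift.\<close>

lemma per_Om_c: "per (Om_c La Ra) = - per (Om_a La Ra)"
proof (intro equalityI subsetI)
  fix t assume "t \<in> per (Om_c La Ra)"
  then obtain s k where s: "t = s + of_int k" "-1/2 \<le> s" "s \<le> 1/2" "\<not> (La < s \<and> s < Ra)"
    by (auto simp: per_def Om_c_def Om_a_def)
  have False if m: "La + of_int m < t" "t < Ra + of_int m" for m :: int
  proof -
    have "real_of_int k - of_int m < 1" "real_of_int m - of_int k < 1" using m s La Ra by linarith+
    then have "k = m" by linarith
    then show False using m s by simp
  qed
  then show "t \<in> - per (Om_a La Ra)" by (auto simp: per_Om_a)
next
  fix t assume t: "t \<in> - per (Om_a La Ra)"
  define m where "m = \<lceil>t - 1/2\<rceil>"
  have m: "-1/2 \<le> t - of_int m" "t - of_int m \<le> 1/2" unfolding m_def by linarith+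
  have "\<not> (La + of_int m < t \<and> t < Ra + of_int m)" using t by (auto simp: per_Om_a)
  then have "t - of_int m \<in> Om_c La Ra" using m by (auto simp: Om_c_def Om_a_def)
  moreover have "t = (t - of_int m) + of_int m" by simp
  ultimately show "t \<in> per (Om_c La Ra)" unfolding per_def by blast
qed

lemma per_Om_a_borel: "per (Om_a La Ra) \<in> sets borel"
  using per_borel[of La Ra] unfolding per_Om_c by (metis borel_comp double_complement)

lemma gap_not_per_Om_a:
  assumes "Ra \<le> t" "t \<le> La + 1"
  shows "t \<notin> per (Om_a La Ra)"
proof -
  have False if "La + of_int m < t" "t < Ra + of_int m" for m :: int
  proof -
    have "(of_int m :: real) < 1" "(of_int m :: real) > 0" using that assms by linarith+
    then show False by simp
  qed
  then show ?thesis by (auto simp: per_Om_a)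
qed

text \<open>Both ends of the gap are nodes, so it contains a whole mesh element, which (T4) bounds
  from below. Hence no bond meets two copies of the atomistic region.\<close>

lemma gap_length: "2 * eps N \<le> La + 1 - Ra"
proof -
  obtain i where i: "Ra = x i" using interfaces by blast
  obtain j where j: "La + 1 = x j" using range_node_shift[OF interfaces(1), of 1] by auto
  have "x i < x j" using La Ra i j by simp
  then have "i + 1 \<le> j" using strict_mono_less[OF mono] by simp
  then have le: "x (i + 1) \<le> La + 1" using j strict_mono_less_eq[OF mono] by simp
  have "elem x (i + 1) \<subseteq> per (Om_c La Ra)"
    unfolding per_Om_c using le i gap_not_per_Om_a by (auto simp: elem_def)
  then have "x (i + 1) - x (i + 1 - 1) \<ge> 2 * eps N" using mesh unfolding is_mesh_def by blast
  then show ?thesis using i le by simp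
qed

text \<open>Inside the copy this is (T2); at its two ends it is (T3).\<close>

lemma lattice_node_atomistic:
  assumes "La + of_int m \<le> lattice N l" "lattice N l \<le> Ra + of_int m"
  shows "lattice N l \<in> range x"
proof -
  have "lattice N l - of_int m = lattice N (l + 2 * int N * (- m))" using lattice_shift[of l "- m"] by simp
  then have r: "lattice N l - of_int m \<in> range (lattice N)" by (metis rangeI)
  have "lattice N l - of_int m \<in> range x"
  proof (cases "lattice N l - of_int m \<in> {La, Ra}")
    case False
    then have "lattice N l - of_int m \<in> Om_a La Ra" using assms by (auto simp: Om_a_def)
    then show ?thesis using r mesh unfolding is_mesh_def by blast
  qed (use interfaces in auto)
  from range_node_shift[OF this, of m] show ?thesis by simp
qed

lemma bond_ends:
  assumes "b \<in> bonds N"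
  shows "lattice N (fst b) < lattice N (fst b + snd b)"
    and "lattice N (fst b + snd b) - lattice N (fst b) = eps N * rb b"
    and "lattice N (fst b + snd b) - lattice N (fst b) \<le> 2 * eps N"
  using assms bond_props(3)[OF N assms]
  by (auto simp: bonds_def lattice_def rb_def algebra_simps)

lemma b_a_cases:
  assumes b: "b \<in> bonds N"
  obtains "b_a N La Ra b = {}"
  | p q where "b_a N La Ra b = {p<..<q}" "p < q" "p \<in> range x" "q \<in> range x"
proof (cases "b_a N La Ra b = {}")
  case False
  let ?l = "lattice N (fst b)" and ?r = "lattice N (fst b + snd b)"
  from False obtain t m where t: "?l < t" "t < ?r" "La + of_int m < t" "t < Ra + of_int m"
    by (auto simp: bond_def per_Om_a)
  \<comment> \<open>Two copies are at least \<open>2 * eps N\<close> apart, whereas two points of an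
    open bond are closer than that.\<close>
  have uniq: "m' = m" if "?l < s" "s < ?r" "La + of_int m' < s" "s < Ra + of_int m'" for s m'
  proof (rule ccontr)
    assume "m' \<noteq> m"
    then have "of_int m' \<ge> of_int m + (1::real) \<or> of_int m \<ge> of_int m' + (1::real)" by linarith
    then show False using that t gap_length bond_ends(3)[OF b] by linarith
  qed
  define p q where "p = max ?l (La + of_int m)" and "q = min ?r (Ra + of_int m)"
  have "b_a N La Ra b = {p<..<q}"
    unfolding p_def q_def using uniq by (auto simp: bond_def per_Om_a)
  moreover have pq: "p < q" unfolding p_def q_def using t by linarith
  moreover have "p \<in> range x"
  proof (cases "?l \<le> La + of_int m")
    case True
    then show ?thesis using range_node_shift[OF interfaces(1), of m] by (simp add: p_def)
  next
    case False
    then show ?thesis using lattice_node_atomistic[of m "fst b"] t by (simp add: p_def)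
  qed
  moreover have "q \<in> range x"
  proof (cases "Ra + of_int m \<le> ?r")
    case True
    then show ?thesis using range_node_shift[OF interfaces(2), of m] by (simp add: q_def)
  next
    case False
    then show ?thesis using lattice_node_atomistic[of m "fst b + snd b"] t by (simp add: q_def)
  qed
  ultimately show thesis using that(2) by blast
qed (use that(1) in blast)

text \<open>\<open>K_c\<close> lists the nodes of one period only; subtracting the ceiling of
  \<open>x i - 1/2\<close> moves a node into the half-open period that the numbering 1 to
  \<open>K\<close> covers.\<close>

lemma continuum_node_representative:
  assumes "x i \<notin> per (Om_a La Ra)"
  obtains k m where "k \<in> K_c La Ra K x" "x i = x k + of_int m"
proof -
  define m where "m = \<lceil>x i - 1/2\<rceil>"
  have m: "-1/2 < x i - of_int m" "x i - of_int m \<le> 1/2" unfolding m_def by linarith+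
  have "x i - of_int m \<in> range x" using range_node_shift[of "x i" "- m"] by simp
  then have "x i - of_int m \<in> x ` {1..int K}" using m mesh unfolding is_mesh_def by auto
  then obtain k where k: "k \<in> {1..int K}" "x i - of_int m = x k" by blast
  have "\<not> (La + of_int m < x i \<and> x i < Ra + of_int m)" using assms by (auto simp: per_Om_a)
  then have "x k \<in> Om_c La Ra" using k m by (auto simp: Om_c_def Om_a_def)
  then show thesis using that[of k m] k by (auto simp: K_c_def)
qed

section \<open>Bond integrals cut at the interfaces\<close>

lemma integral_bond_split:
  assumes f: "loc_bdd f"
  shows "(LINT t:bond N b|lborel. f t) =
    (LINT t:b_a N La Ra b|lborel. f t) + (LINT t:b_c N La Ra b|lborel. f t)"
proof -
  have S: "bounded (bond N b)" "bond N b \<in> sets borel" by (auto simp: bond_def)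
  have "bond N b = b_a N La Ra b \<union> b_c N La Ra b" by (auto simp: per_Om_c)
  then have "(LINT t:bond N b|lborel. f t) = (LINT t:b_a N La Ra b \<union> b_c N La Ra b|lborel. f t)"
    by simp
  also have "\<dots> = (LINT t:b_a N La Ra b|lborel. f t) + (LINT t:b_c N La Ra b|lborel. f t)"
  proof (intro set_integral_Un loc_bdd_set_integrable f sets.Int S per_borel per_Om_a_borel bounded_Int disjI1)
  qed (auto simp: per_Om_c)
  finally show ?thesis .
qed

lemma integral_b_a_deriv:
  assumes b: "b \<in> bonds N" and V: "V \<in> P1 (lattice N)"
  shows "len (b_a N La Ra b) * Dq (b_a N La Ra b) V = (LINT t:b_a N La Ra b|lborel. deriv V t)"
proof (rule b_a_cases[OF b])
  fix p q assume "b_a N La Ra b = {p<..<q}" "p < q"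
  then show ?thesis using lat.integral_deriv_P1[OF V, of p q] by (simp add: Dq_def)
qed (simp add: set_lebesgue_integral_def)

lemma integral_bond_deriv:
  assumes b: "b \<in> bonds N" and V: "V \<in> P1 (lattice N)"
  shows "eps N * (rb b * Dq (bond N b) V) = (LINT t:bond N b|lborel. deriv V t)"
  using lat.integral_deriv_P1[OF V less_imp_le[OF bond_ends(1)[OF b]]] bond_ends(1,2)[OF b]
    bond_props(2,3)[OF N b]
  by (simp add: bond_def Dq_def)

section \<open>Invariance of the quasicontinuum residual under nodal interpolation\<close>

text \<open>The difference of a function and its nodal interpolant vanishes at the nodes. The end points
  of each \<open>b_a\<close> are nodes, and the bonds of length \<open>j\<close> cover the period \<open>j\<close> times, so that the
  continuum part reduces to integrals of the derivative of the difference over mesh elements.\<close>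

lemma dE_qc_nodal:
  assumes y: "y \<in> P1 x" and yp: "\<And>t. y (t + 1) = y t + F"
    and V: "V \<in> P1 (lattice N)" and Vp: "\<And>t. V (t + 1) = V t"
    and w: "w \<in> P1 x" and wp: "\<And>t. w (t + 1) = w t"
    and wV: "\<And>k. w (x k) = V (x k)"
  shows "dE_qc N \<phi> La Ra y w = dE_qc N \<phi> La Ra y V"
proof -
  have ly: "step_fun (deriv y)" by (rule step_fun_deriv_P1[OF y])
  have lw: "loc_bdd (deriv w)" by (intro step_fun_loc_bdd step_fun_deriv_P1 w)
  have lV: "loc_bdd (deriv V)" by (intro lat.step_fun_loc_bdd lat.step_fun_deriv_P1 V)
  have lphi: "loc_bdd (\<lambda>t. deriv \<phi> (r * deriv y t))" for r
    by (intro step_fun_loc_bdd step_fun_comp[OF ly])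
  have a: "Dq (b_a N La Ra b) w = Dq (b_a N La Ra b) V \<or> len (b_a N La Ra b) = 0" if b: "b \<in> bonds N" for b
  proof (rule b_a_cases[OF b])
    fix p q assume "b_a N La Ra b = {p<..<q}" "p < q" "p \<in> range x" "q \<in> range x"
    then show ?thesis using wV by (auto simp: Dq_def)
  qed simp
  \<comment> \<open>Extension by zero to the atomistic region turns integrals over
    \<open>b_c\<close> into integrals over whole bonds, to which the periodic count applies.\<close>
  define f where "f j t = (if t \<in> per (Om_a La Ra) then 0 else
      deriv \<phi> (real_of_int j * deriv y t) * (deriv w t - deriv V t))" for j t
  have lf: "loc_bdd (f j)" for j
    unfolding f_def by (intro loc_bdd_if per_Om_a_borel loc_bdd_const loc_bdd_mult lphi loc_bdd_diff lw lV)
  have fp: "f j (t + 1) = f j t" for j t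
    unfolding f_def per_Om_a_shift
    using deriv_shift[of y F t, OF yp] deriv_shift[of w 0 t] deriv_shift[of V 0 t] wp Vp by simp
  \<comment> \<open>The period is taken to start at \<open>Ra\<close>: up to \<open>La + 1\<close>
    it consists of whole mesh elements, and from there to \<open>Ra + 1\<close> the integrand is
    zero.\<close>
  have zero: "(LINT t:{-1/2<..<1/2}|lborel. f j t) = 0" for j
  proof -
    obtain P where P: "\<And>a b. a \<le> b \<Longrightarrow> (LINT t:{a<..<b}|lborel. f j t) = P b - P a"
      "\<And>a. P (a + 1) - P a = (LINT t:{-1/2<..<1/2}|lborel. f j t)"
      using periodic_primitive[OF lf fp] by blast
    obtain i where i: "Ra = x i" using interfaces by blast
    obtain l where l: "La + 1 = x l" using range_node_shift[OF interfaces(1), of 1] by auto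
    have "x i < x l" using La Ra i l by simp
    then have il: "i \<le> l" using strict_mono_less[OF mono] by simp
    have elem0: "P (x k) = P (x (k - 1))" if k: "i < k" "k \<le> l" for k
    proof -
      have lt: "x (k - 1) < x k" using strict_monoD[OF mono] by simp
      have bd: "Ra \<le> x (k - 1)" "x k \<le> La + 1" using k i l strict_mono_less_eq[OF mono] by auto
      obtain c where c: "\<And>t. x (k - 1) < t \<Longrightarrow> t < x k \<Longrightarrow> deriv y t = c"
        using ly unfolding step_fun_def by blast
      have "f j t = deriv \<phi> (real_of_int j * c) * (deriv w t - deriv V t)" if "t \<in> {x (k - 1)<..<x k}" for t
        using gap_not_per_Om_a[of t] c[of t] that bd by (simp add: f_def)
      then have "(LINT t:{x (k - 1)<..<x k}|lborel. f j t) =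
          (LINT t:{x (k - 1)<..<x k}|lborel. deriv \<phi> (real_of_int j * c) * (deriv w t - deriv V t))"
        by (intro set_lebesgue_integral_cong) auto
      also have "\<dots> = deriv \<phi> (real_of_int j * c) *
          ((LINT t:{x (k - 1)<..<x k}|lborel. deriv w t) - (LINT t:{x (k - 1)<..<x k}|lborel. deriv V t))"
        by (simp add: set_integral_diff loc_bdd_Ioo lw lV)
      also have "\<dots> = 0"
        using lt wV by (simp add: integral_deriv_P1[OF w] lat.integral_deriv_P1[OF V])
      finally show ?thesis using P(1)[of "x (k - 1)" "x k"] lt by simp
    qed
    have "P (x (i + int n)) = P (x i)" if "i + int n \<le> l" for n
      using that
    proof (induction n)
      case (Suc n)
      then show ?case using elem0[of "i + int (Suc n)"] by (simp add: algebra_simps)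
    qed simp
    from this[of "nat (l - i)"] have "P (La + 1) = P Ra" using il i l by simp
    moreover have "(LINT t:{La + 1<..<Ra + 1}|lborel. f j t) = 0"
    proof -
      have "f j t = 0" if "t \<in> {La + 1<..<Ra + 1}" for t
      proof -
        have "t \<in> per (Om_a La Ra)" using that unfolding per_Om_a by (intro exI[of _ 1]) auto
        then show ?thesis by (simp add: f_def)
      qed
      then have "(LINT t:{La + 1<..<Ra + 1}|lborel. f j t) = (LINT t:{La + 1<..<Ra + 1}|lborel. 0)"
        by (intro set_lebesgue_integral_cong) auto
      then show ?thesis by simp
    qed
    ultimately show ?thesis using P(1)[of "La + 1" "Ra + 1"] P(2)[of Ra] LaRa by simp
  qed
  have S: "bounded (b_c N La Ra b)" "b_c N La Ra b \<in> sets borel" for b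
    using per_borel by (auto simp: bond_def)
  have c: "(LINT t:b_c N La Ra b|lborel. deriv \<phi> (rb b * deriv y t) * deriv w t) -
      (LINT t:b_c N La Ra b|lborel. deriv \<phi> (rb b * deriv y t) * deriv V t) =
      (LINT t:bond N b|lborel. f (snd b) t)" for b
  proof -
    have "(LINT t:b_c N La Ra b|lborel. deriv \<phi> (rb b * deriv y t) * deriv w t) -
        (LINT t:b_c N La Ra b|lborel. deriv \<phi> (rb b * deriv y t) * deriv V t) =
        (LINT t:b_c N La Ra b|lborel. deriv \<phi> (rb b * deriv y t) * (deriv w t - deriv V t))"
      unfolding right_diff_distrib
      by (intro set_integral_diff(2)[symmetric] loc_bdd_set_integrable loc_bdd_mult lphi lw lV S)
    also have "\<dots> = (LINT t:bond N b|lborel. f (snd b) t)"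
      unfolding set_lebesgue_integral_def
      by (intro Bochner_Integration.integral_cong) (auto simp: f_def rb_def per_Om_c indicator_def)
    finally show ?thesis .
  qed
  have "dE_qc N \<phi> La Ra y w - dE_qc N \<phi> La Ra y V =
      (\<Sum>b\<in>bonds N. len (b_a N La Ra b) * deriv \<phi> (rb b * Dq (b_a N La Ra b) y) * Dq (b_a N La Ra b) w -
         len (b_a N La Ra b) * deriv \<phi> (rb b * Dq (b_a N La Ra b) y) * Dq (b_a N La Ra b) V) +
      (\<Sum>b\<in>bonds N. (LINT t:b_c N La Ra b|lborel. deriv \<phi> (rb b * deriv y t) * deriv w t) -
         (LINT t:b_c N La Ra b|lborel. deriv \<phi> (rb b * deriv y t) * deriv V t))"
    unfolding dE_qc_def by (simp add: sum_subtractf)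
  also have "(\<Sum>b\<in>bonds N. len (b_a N La Ra b) * deriv \<phi> (rb b * Dq (b_a N La Ra b) y) * Dq (b_a N La Ra b) w -
         len (b_a N La Ra b) * deriv \<phi> (rb b * Dq (b_a N La Ra b) y) * Dq (b_a N La Ra b) V) = 0"
    by (intro sum.neutral ballI) (use a in force)
  also have "(\<Sum>b\<in>bonds N. (LINT t:b_c N La Ra b|lborel. deriv \<phi> (rb b * deriv y t) * deriv w t) -
         (LINT t:b_c N La Ra b|lborel. deriv \<phi> (rb b * deriv y t) * deriv V t)) = 0"
    unfolding c using sum_bonds_periodic[OF N lf fp] zero by simp
  finally show ?thesis by simp
qed

section \<open>The residual estimate\<close>

text \<open>Glues the two integrands of the indicator into one function on the whole bond. If
  \<open>b_a\<close> is empty, no point of the bond reaches the branch with the unspecified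
  \<open>Dq\<close>.\<close>

definition stress_error :: "(real \<Rightarrow> real) \<Rightarrow> (real \<Rightarrow> real) \<Rightarrow> int \<times> int \<Rightarrow> real \<Rightarrow> real" where
  "stress_error \<phi> y b t = deriv \<phi> (rb b * Dq (bond N b) y) -
     (if t \<in> per (Om_a La Ra) then deriv \<phi> (rb b * Dq (b_a N La Ra b) y) else deriv \<phi> (rb b * deriv y t))"

lemma loc_bdd_stress_error:
  assumes "y \<in> P1 x"
  shows "loc_bdd (stress_error \<phi> y b)"
  unfolding stress_error_def
  by (intro loc_bdd_diff loc_bdd_const loc_bdd_if per_Om_a_borel step_fun_loc_bdd
      step_fun_comp[OF step_fun_deriv_P1[OF assms]])

text \<open>The interfaces are continuum nodes themselves, so a bond without continuum nodes is not
  cut by one. In the atomistic region \<open>b_a\<close> is the full bond; outside, \<open>y\<close>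
  is affine on the bond and its difference quotient is its slope.\<close>

lemma stress_error_zero:
  assumes y: "y \<in> P1 x" and b: "b \<in> bonds N"
    and none: "\<And>k m. k \<in> K_c La Ra K x \<Longrightarrow> x k + of_int m \<notin> bond N b"
    and t: "t \<in> bond N b"
  shows "stress_error \<phi> y b t = 0"
proof -
  let ?l = "lattice N (fst b)" and ?r = "lattice N (fst b + snd b)"
  have node: "s \<in> per (Om_a La Ra)" if s: "s \<in> range x" "s \<in> bond N b" for s
  proof (rule ccontr)
    assume "s \<notin> per (Om_a La Ra)"
    then show False using s none continuum_node_representative by (metis imageE)
  qed
  have cut: "La + of_int m \<notin> bond N b" "Ra + of_int m \<notin> bond N b" for m
  proof -
    have "s + of_int m \<notin> per (Om_a La Ra)" if "s \<in> {La, Ra}" for s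
    proof -
      have "False" if "La + of_int j < s + of_int m" "s + of_int m < Ra + of_int j" for j :: int
      proof -
        have "real_of_int j < of_int m + 1" "real_of_int m < of_int j + 1"
          using that \<open>s \<in> {La, Ra}\<close> La Ra LaRa by auto
        then have "j = m" by linarith
        then show False using that \<open>s \<in> {La, Ra}\<close> by auto
      qed
      then show ?thesis by (auto simp: per_Om_a)
    qed
    then show "La + of_int m \<notin> bond N b" "Ra + of_int m \<notin> bond N b"
      using node range_node_shift interfaces by blast+
  qed
  show ?thesis
  proof (cases "bond N b \<subseteq> per (Om_a La Ra)")
    case True
    then have "b_a N La Ra b = bond N b" by blast
    then show ?thesis using True t by (auto simp: stress_error_def)
  next
    case False
    have disj: "bond N b \<inter> per (Om_a La Ra) = {}"
    proof (rule ccontr)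
      assume "bond N b \<inter> per (Om_a La Ra) \<noteq> {}"
      then obtain s m where s: "?l < s" "s < ?r" "La + of_int m < s" "s < Ra + of_int m"
        by (auto simp: bond_def per_Om_a)
      then have "La + of_int m \<le> ?l" "?r \<le> Ra + of_int m" using cut[of m] by (auto simp: bond_def)
      then have "bond N b \<subseteq> per (Om_a La Ra)" by (auto simp: bond_def per_Om_a intro!: exI[of _ m])
      then show False using False by blast
    qed
    obtain k where k: "x (k - 1) \<le> t" "t < x k" using elem_exists[OF mono cover] by blast
    \<comment> \<open>A node in the bond would be atomistic by \<open>node\<close>, contradicting
      \<open>disj\<close>. So the element around \<open>t\<close> contains the closed bond.\<close>
    have "x (k - 1) \<notin> bond N b" "x k \<notin> bond N b" using disj node by blast+
    then have sub: "x (k - 1) \<le> ?l" "?r \<le> x k" using k t by (auto simp: bond_def)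
    obtain p s where ps: "\<And>u. u \<in> elem x k \<Longrightarrow> y u = p + s * u" using y unfolding P1_def by blast
    have "(y has_real_derivative s) (at t)"
    proof (rule has_field_derivative_transform_within_open[where S = "bond N b"])
      show "((\<lambda>u. p + s * u) has_real_derivative s) (at t)" by (auto intro!: derivative_eq_intros)
      show "p + s * u = y u" if "u \<in> bond N b" for u
        using ps[of u] that sub by (simp add: elem_def bond_def)
    qed (use t in \<open>auto simp: bond_def\<close>)
    then have "deriv y t = s" by (rule DERIV_imp_deriv)
    moreover have "Dq (bond N b) y = s"
    proof -
      have "y ?r - y ?l = s * (?r - ?l)"
        using ps[of ?r] ps[of ?l] sub bond_ends(1)[OF b] by (simp add: elem_def algebra_simps)
      then show ?thesis using bond_ends(1)[OF b] by (simp add: Dq_def bond_def)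
    qed
    ultimately show ?thesis using disj t by (auto simp: stress_error_def)
  qed
qed

text \<open>Length times difference quotient is the integral of the derivative, on the bond and on
  \<open>b_a\<close>. On \<open>b_a\<close> both stresses are constants, so all terms combine under
  one integral.\<close>

lemma residual_stress_error:
  assumes y: "y \<in> P1 x" and V: "V \<in> P1 (lattice N)"
  shows "dE_a N \<phi> y V - dE_qc N \<phi> La Ra y V =
    (\<Sum>b\<in>bonds N. LINT t:bond N b|lborel. stress_error \<phi> y b t * deriv V t)"
proof -
  have lV: "loc_bdd (deriv V)" by (intro lat.step_fun_loc_bdd lat.step_fun_deriv_P1 V)
  have lphi: "loc_bdd (\<lambda>t. deriv \<phi> (r * deriv y t))" for r
    by (intro step_fun_loc_bdd step_fun_comp[OF step_fun_deriv_P1[OF y]])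
  have bond_eq: "eps N * (deriv \<phi> (rb b * Dq (bond N b) y) * (rb b * Dq (bond N b) V)) -
      (len (b_a N La Ra b) * deriv \<phi> (rb b * Dq (b_a N La Ra b) y) * Dq (b_a N La Ra b) V +
       (LINT t:b_c N La Ra b|lborel. deriv \<phi> (rb b * deriv y t) * deriv V t)) =
      (LINT t:bond N b|lborel. stress_error \<phi> y b t * deriv V t)" if b: "b \<in> bonds N" for b
  proof -
    define c1 c2 where "c1 = deriv \<phi> (rb b * Dq (bond N b) y)" and "c2 = deriv \<phi> (rb b * Dq (b_a N La Ra b) y)"
    have S: "bounded (b_c N La Ra b)" "b_c N La Ra b \<in> sets borel" "b_a N La Ra b \<in> sets borel"
      using per_borel per_Om_a_borel by (auto simp: bond_def)
    have A: "(LINT t:b_a N La Ra b|lborel. stress_error \<phi> y b t * deriv V t) =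
        (c1 - c2) * (LINT t:b_a N La Ra b|lborel. deriv V t)"
      unfolding set_integral_mult_right[symmetric]
      by (intro set_lebesgue_integral_cong) (use S in \<open>auto simp: stress_error_def c1_def c2_def\<close>)
    have "(LINT t:b_c N La Ra b|lborel. stress_error \<phi> y b t * deriv V t) =
        (LINT t:b_c N La Ra b|lborel. c1 * deriv V t - deriv \<phi> (rb b * deriv y t) * deriv V t)"
      by (intro set_lebesgue_integral_cong)
        (use S in \<open>auto simp: stress_error_def c1_def per_Om_c algebra_simps\<close>)
    also have "\<dots> = c1 * (LINT t:b_c N La Ra b|lborel. deriv V t) -
        (LINT t:b_c N La Ra b|lborel. deriv \<phi> (rb b * deriv y t) * deriv V t)"
      unfolding set_integral_mult_right[symmetric]
      by (intro set_integral_diff(2) loc_bdd_set_integrable loc_bdd_mult loc_bdd_const lV lphi S)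
    finally have C: "(LINT t:b_c N La Ra b|lborel. stress_error \<phi> y b t * deriv V t) = \<dots>" .
    have "eps N * (c1 * (rb b * Dq (bond N b) V)) = c1 * (LINT t:bond N b|lborel. deriv V t)"
      unfolding integral_bond_deriv[OF b V, symmetric] by simp
    moreover have "len (b_a N La Ra b) * c2 * Dq (b_a N La Ra b) V = c2 * (LINT t:b_a N La Ra b|lborel. deriv V t)"
      unfolding integral_b_a_deriv[OF b V, symmetric] by simp
    ultimately show ?thesis
      unfolding c1_def[symmetric] c2_def[symmetric] integral_bond_split[OF lV]
        integral_bond_split[OF loc_bdd_mult[OF loc_bdd_stress_error[OF y] lV]] A C
      by (auto simp: algebra_simps)
  qed
  show ?thesis
    unfolding dE_a_def dE_qc_def sum_distrib_left sum.distrib[symmetric] sum_subtractf[symmetric]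
    by (intro sum.cong refl bond_eq)
qed

section \<open>From stress errors to indicators and the dual norm\<close>

lemma L2_norm_power2: "(L2_norm S f)\<^sup>2 = (LINT t:S|lborel. (f t)\<^sup>2)"
proof -
  have "(LINT t:S|lborel. (f t)\<^sup>2) \<ge> 0"
    unfolding set_lebesgue_integral_def by (intro Bochner_Integration.integral_nonneg) simp
  then show ?thesis by (simp add: L2_norm_def)
qed

text \<open>Double counting: after exchanging the sums, a bond appears once for each index in
  \<open>K_c\<close> whose node it contains modulo 1, hence at least once unless its error is
  zero.\<close>

lemma sum_stress_error_le_eta:
  assumes y: "y \<in> P1 x"
  shows "(\<Sum>b\<in>bonds N. LINT t:bond N b|lborel. (stress_error \<phi> y b t)\<^sup>2) \<le>
    (\<Sum>k\<in>K_c La Ra K x. eta_sq N \<phi> La Ra x y k)"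
proof -
  define e where "e b = (LINT t:bond N b|lborel. (stress_error \<phi> y b t)\<^sup>2)" for b
  have e0: "e b \<ge> 0" for b
    unfolding e_def set_lebesgue_integral_def by (intro Bochner_Integration.integral_nonneg) simp
  have fin: "finite (K_c La Ra K x)" by (rule finite_subset[of _ "{1..int K}"]) (auto simp: K_c_def)
  have eta: "eta_sq N \<phi> La Ra x y k = (\<Sum>b\<in>{b \<in> bonds N. \<exists>m::int. x k + of_int m \<in> bond N b}. e b)" for k
    unfolding eta_sq_def
  proof (intro sum.cong refl)
    fix b
    have S: "b_c N La Ra b \<in> sets borel" "b_a N La Ra b \<in> sets borel"
      using per_borel per_Om_a_borel by (auto simp: bond_def)
    have "e b = (LINT t:b_a N La Ra b|lborel. (stress_error \<phi> y b t)\<^sup>2) +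
        (LINT t:b_c N La Ra b|lborel. (stress_error \<phi> y b t)\<^sup>2)"
      unfolding e_def by (intro integral_bond_split loc_bdd_power2 loc_bdd_stress_error y)
    also have "(LINT t:b_a N La Ra b|lborel. (stress_error \<phi> y b t)\<^sup>2) = (LINT t:b_a N La Ra b|lborel.
        (deriv \<phi> (rb b * Dq (bond N b) y) - deriv \<phi> (rb b * Dq (b_a N La Ra b) y))\<^sup>2)"
      by (intro set_lebesgue_integral_cong) (use S in \<open>auto simp: stress_error_def\<close>)
    also have "(LINT t:b_c N La Ra b|lborel. (stress_error \<phi> y b t)\<^sup>2) = (LINT t:b_c N La Ra b|lborel.
        (deriv \<phi> (rb b * Dq (bond N b) y) - deriv \<phi> (rb b * deriv y t))\<^sup>2)"
      by (intro set_lebesgue_integral_cong) (use S in \<open>auto simp: stress_error_def per_Om_c\<close>)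
    finally show "(L2_norm (b_a N La Ra b)
           (\<lambda>t. deriv \<phi> (rb b * Dq (bond N b) y) - deriv \<phi> (rb b * Dq (b_a N La Ra b) y)))\<^sup>2
      + (L2_norm (b_c N La Ra b)
           (\<lambda>t. deriv \<phi> (rb b * Dq (bond N b) y) - deriv \<phi> (rb b * deriv y t)))\<^sup>2 = e b"
      unfolding L2_norm_power2 by simp
  qed
  have "e b \<le> (\<Sum>k\<in>K_c La Ra K x. if \<exists>m::int. x k + of_int m \<in> bond N b then e b else 0)"
    if b: "b \<in> bonds N" for b
  proof (cases "\<exists>k\<in>K_c La Ra K x. \<exists>m::int. x k + of_int m \<in> bond N b")
    case True
    then obtain k where k: "k \<in> K_c La Ra K x" "\<exists>m::int. x k + of_int m \<in> bond N b" by blast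
    then have "e b = (if \<exists>m::int. x k + of_int m \<in> bond N b then e b else 0)" by simp
    also have "\<dots> \<le> (\<Sum>k\<in>K_c La Ra K x. if \<exists>m::int. x k + of_int m \<in> bond N b then e b else 0)"
      by (rule member_le_sum[OF k(1)]) (use fin e0 in auto)
    finally show ?thesis .
  next
    case False
    then have "stress_error \<phi> y b t = 0" if "t \<in> bond N b" for t
      using stress_error_zero[OF y b _ that] by blast
    then have "e b = (LINT t:bond N b|lborel. 0)"
      unfolding e_def by (intro set_lebesgue_integral_cong) (auto simp: bond_def)
    then show ?thesis using False by simp
  qed
  then have "(\<Sum>b\<in>bonds N. e b) \<le>
      (\<Sum>b\<in>bonds N. \<Sum>k\<in>K_c La Ra K x. if \<exists>m::int. x k + of_int m \<in> bond N b then e b else 0)"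
    by (rule sum_mono)
  also have "\<dots> = (\<Sum>k\<in>K_c La Ra K x. \<Sum>b\<in>bonds N. if \<exists>m::int. x k + of_int m \<in> bond N b then e b else 0)"
    by (rule sum.swap)
  also have "\<dots> = (\<Sum>k\<in>K_c La Ra K x. eta_sq N \<phi> La Ra x y k)"
    unfolding eta by (simp add: sum.inter_filter finite_bonds)
  finally show ?thesis unfolding e_def .
qed

lemma residual_le:
  assumes y: "y \<in> P1 x" and V: "V \<in> P1 (lattice N)" and Vp: "\<And>t. V (t + 1) = V t"
    and norm: "(LINT t:{-1/2<..<1/2}|lborel. (deriv V t)\<^sup>2) = 1"
  shows "dE_a N \<phi> y V - dE_qc N \<phi> La Ra y V \<le>
    sqrt (3 * (\<Sum>b\<in>bonds N. LINT t:bond N b|lborel. (stress_error \<phi> y b t)\<^sup>2))" (is "?R \<le> sqrt (3 * ?G)")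
proof -
  have lV: "loc_bdd (deriv V)" by (intro lat.step_fun_loc_bdd lat.step_fun_deriv_P1 V)
  have le: "loc_bdd (stress_error \<phi> y b)" for b by (rule loc_bdd_stress_error[OF y])
  have I: "set_integrable lborel (bond N b) f" if "loc_bdd f" for f b
    unfolding bond_def by (rule loc_bdd_Ioo[OF that])
  \<comment> \<open>Origin of the constant: one unit from the bonds of length one and two from those
    of length two, for a test function of norm 1.\<close>
  have H: "(\<Sum>b\<in>bonds N. LINT t:bond N b|lborel. (deriv V t)\<^sup>2) = 3"
    using sum_bonds_periodic[OF N, of "\<lambda>_ t. (deriv V t)\<^sup>2"] deriv_shift[of V 0] Vp norm
    by (simp add: loc_bdd_power2 lV)
  \<comment> \<open>Young's inequality with a free parameter, optimised below, replaces Cauchy-Schwarz.\<close>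
  have young: "2 * ?R \<le> s * ?G + 3 / s" if s: "s > 0" for s
  proof -
    have "2 * (LINT t:bond N b|lborel. stress_error \<phi> y b t * deriv V t) \<le>
        s * (LINT t:bond N b|lborel. (stress_error \<phi> y b t)\<^sup>2) + (LINT t:bond N b|lborel. (deriv V t)\<^sup>2) / s" for b
    proof -
      have pt: "2 * (g * v) \<le> s * g\<^sup>2 + (1 / s) * v\<^sup>2" for g v :: real
      proof -
        have "0 \<le> (s * g - v)\<^sup>2 / s" using s by simp
        also have "\<dots> = s * g\<^sup>2 + (1 / s) * v\<^sup>2 - 2 * (g * v)"
          using s by (simp add: power2_eq_square field_simps)
        finally show ?thesis by simp
      qed
      have "(LINT t:bond N b|lborel. 2 * (stress_error \<phi> y b t * deriv V t)) \<le>
          (LINT t:bond N b|lborel. s * (stress_error \<phi> y b t)\<^sup>2 + (1 / s) * (deriv V t)\<^sup>2)"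
        by (intro set_integral_mono I loc_bdd_add loc_bdd_mult loc_bdd_const loc_bdd_power2 le lV pt)
      also have "\<dots> = (LINT t:bond N b|lborel. s * (stress_error \<phi> y b t)\<^sup>2) +
          (LINT t:bond N b|lborel. (1 / s) * (deriv V t)\<^sup>2)"
        by (intro set_integral_add I loc_bdd_mult loc_bdd_const loc_bdd_power2 le lV)
      finally show ?thesis unfolding set_integral_mult_right by simp
    qed
    then have "(\<Sum>b\<in>bonds N. 2 * (LINT t:bond N b|lborel. stress_error \<phi> y b t * deriv V t)) \<le>
        (\<Sum>b\<in>bonds N. s * (LINT t:bond N b|lborel. (stress_error \<phi> y b t)\<^sup>2) + (LINT t:bond N b|lborel. (deriv V t)\<^sup>2) / s)"
      by (rule sum_mono)
    then show ?thesis
      unfolding residual_stress_error[OF y V]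
      by (simp add: sum.distrib sum_distrib_left[symmetric] sum_divide_distrib[symmetric] H)
  qed
  have "?G \<ge> 0"
    unfolding set_lebesgue_integral_def by (intro sum_nonneg Bochner_Integration.integral_nonneg) simp
  then consider "?G = 0" | "?G > 0" by linarith
  then show ?thesis
  proof cases
    case 1
    have "?R \<le> 0"
    proof (rule ccontr)
      assume "\<not> ?R \<le> 0"
      \<comment> \<open>Here Young's bound reads \<open>2 * ?R \<le> 3 / s\<close> for every
        positive \<open>s\<close>; the choice of \<open>s\<close> turns the right-hand side into
        \<open>?R\<close>.\<close>
      then show False using young[of "3 / ?R"] 1 by simp
    qed
    then show ?thesis using 1 by simp
  next
    case 2
    \<comment> \<open>The minimiser of \<open>s * ?G + 3 / s\<close> is \<open>s = 3 / r\<close>,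
      where both summands equal \<open>r\<close>.\<close>
    define r where "r = sqrt (3 * ?G)"
    have r: "r > 0" "r\<^sup>2 = 3 * ?G" using 2 by (auto simp: r_def)
    have "2 * ?R \<le> 3 / r * ?G + r" using young[of "3 / r"] r by simp
    also have "3 / r * ?G = r" using r by (simp add: power2_eq_square field_simps)
    finally show ?thesis by (simp add: r_def)
  qed
qed

end

theorem theorem1:
  fixes N K :: nat and F La Ra :: real and \<phi> :: "real \<Rightarrow> real"
    and x :: "int \<Rightarrow> real" and y :: "real \<Rightarrow> real"
  assumes "N \<ge> 1" and "F > 0"
    and "C3_pos \<phi>" and "convex_concave \<phi>"
    and "-1/2 < La" and "La < Ra" and "Ra < 1/2"
    and "is_mesh N La Ra K x"
    and "y \<in> Y_h F x" and "pos_deriv x y"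
  shows "dual_norm N (R_int N \<phi> La Ra x y)
           \<le> ereal (sqrt (3 * (\<Sum>k\<in>K_c La Ra K x. eta_sq N \<phi> La Ra x y k)))"
proof -
  interpret qc_mesh N K La Ra x using assms by unfold_locales
  have y: "y \<in> P1 x" using assms(9) by (simp add: Y_h_def)
  have yp: "y (t + 1) = y t + F" for t
  proof -
    have "y (t + 1) - F * (t + 1) = y t - F * t" using assms(9) by (auto simp: Y_h_def U_h_def)
    then show ?thesis by (simp add: algebra_simps)
  qed
  have "R_int N \<phi> La Ra x y v \<le> sqrt (3 * (\<Sum>k\<in>K_c La Ra K x. eta_sq N \<phi> La Ra x y k))"
    if v: "v \<in> U_eps N" "norm_U12 N v = 1" for v
  proof -
    define V where "V = interp (lattice N) v"
    define w where "w = nodal_interp x V"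
    have V: "V \<in> P1 (lattice N)" unfolding V_def by (rule interp_P1[OF lat.mono lat.cover])
    have Vp: "V (t + 1) = V t" for t
      unfolding V_def
      by (rule lat.interp_periodic[of "2 * int N"]) (use v lattice_shift[of _ 1] in \<open>auto simp: U_eps_def\<close>)
    have w: "w \<in> P1 x" and wV: "\<And>k. w (x k) = V (x k)"
      unfolding w_def nodal_interp_def using interp_P1[OF mono cover] by auto
    have wp: "w (t + 1) = w t" for t
      unfolding w_def nodal_interp_def
      by (rule interp_periodic[of "int K"]) (simp_all add: mesh_periodic Vp)
    have "(LINT t:{-1/2<..<1/2}|lborel. (deriv V t)\<^sup>2) = 1"
      using v(2) L2_norm_power2[of "{-1/2<..<1/2}" "deriv V"] by (simp add: norm_U12_def V_def)
    note residual_le[OF y V Vp this, of \<phi>]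
    also have "sqrt (3 * (\<Sum>b\<in>bonds N. LINT t:bond N b|lborel. (stress_error \<phi> y b t)\<^sup>2)) \<le>
        sqrt (3 * (\<Sum>k\<in>K_c La Ra K x. eta_sq N \<phi> La Ra x y k))"
      using sum_stress_error_le_eta[OF y, of \<phi>] by simp
    \<comment> \<open>The bound so far has \<open>V\<close> in both derivatives;
      \<open>dE_qc_nodal\<close> puts the interpolant \<open>w\<close> back into the quasicontinuum
      one, as \<open>R_int\<close> requires.\<close>
    finally show ?thesis
      using dE_qc_nodal[OF y yp V Vp w wp wV, of \<phi>] by (simp add: R_int_def V_def w_def)
  qed
  then show ?thesis unfolding dual_norm_def by (intro SUP_least) auto
qed

end
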